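(* Let $G=(V,A;S,T)$ be a directed graph with vertex set $V$, arc set $A$, entrance set $S$ and exit set $T$, where $S$ and $T$ are disjoint subsets of $V$. For each $a\in A$ let $\varphi_a:\mathbb{Z}\to\mathbb{R}\cup\{+\infty\}$ be a function that is convex in the sense that $\varphi_a(t-1)+\varphi_a(t+1)\ge 2\varphi_a(t)$ for all $t\in\mathbb{Z}$, and let $f:\mathbb{Z}^S\to\mathbb{R}\cup\{+\infty\}$ be jump M$^\natural$-convex. Define $g:\mathbb{Z}^T\to\mathbb{R}\cup\{+\infty,-\infty\}$ by $$g(y)=\inf_{\xi,x}\Big\{f(x)+\sum_{a\in A}\varphi_a(\xi(a))\ \Big|\ \partial\xi=(x,-y,\mathbf{0}),\ \xi\in\mathbb{Z}^A,\ (x,-y,\mathbf{0})\in\mathbb{Z}^S\times\mathbb{Z}^T\times\mathbb{Z}^{V\setminus(S\cup T)}\Big\}\quad(y\in\mathbb{Z}^T),$$ with $g(y)=+\infty$ if no such $(\xi,x)$ exists. Then $g$ is jump M$^\natural$-convex, provided that $\operatorname{dom} g\neq\emptyset$ and $g>-\infty$ (i.e. $g(y)>-\infty$ for all $y$).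
   Context: For $\xi\in\mathbb{Z}^A$, $\partial\xi\in\mathbb{Z}^V$ is the vector of net supplies: $\partial\xi(v)=\sum_{a:\,a\text{ leaves }v}\xi(a)-\sum_{a:\,a\text{ enters }v}\xi(a)$ for $v\in V$. The condition $\partial\xi=(x,-y,\mathbf{0})$ means that $\partial\xi(v)=x_v$ for $v\in S$, $\partial\xi(v)=-y_v$ for $v\in T$, and $\partial\xi(v)=0$ for $v\in V\setminus(S\cup T)$. For a finite index set $N$ and a function $f:\mathbb{Z}^N\to\mathbb{R}\cup\{+\infty\}$, the effective domain is $\operatorname{dom} f=\{x\in\mathbb{Z}^N\mid f(x)<+\infty\}$; it is always assumed to be nonempty. $\mathbf{1}^i$ denotes the $i$th unit vector. For integer vectors $x,y$, let $x\vee y$ and $x\wedge y$ be the componentwise maximum and minimum, and $[x\wedge y,x\vee y]_{\mathbb{Z}}$ the set of integer vectors $z$ with $x\wedge y\le z\le x\vee y$ componentwise. A vector $s\in\mathbb{Z}^N$ is an $(x,y)$-increment if $s=\mathbf{1}^i$ or $s=-\mathbf{1}^i$ for some $i\in N$ and $x+s\in[x\wedge y,x\vee y]_{\mathbb{Z}}$. A function $f$ is jump M$^\natural$-convex if it satisfies the following exchange axiom: for any $x,y\in\operatorname{dom} f$ and any $(x,y)$-increment $s$, (i) or (ii) holds: (i) $x+s\in\operatorname{dom} f$, $y-s\in\operatorname{dom} f$, and $f(x)+f(y)\ge f(x+s)+f(y-s)$; (ii) there exists an $(x+s,y)$-increment $t$ such that $x+s+t\in\operatorname{dom} f$, $y-s-t\in\operatorname{dom}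 f$, and $f(x)+f(y)\ge f(x+s+t)+f(y-s-t)$.
   Formalization: Each φ_a is also required to have an effective domain without holes (an interval of integers); the inequality alone allows φ=0 on {0,3}, +∞ elsewhere, and then one arc from S to T with f=0 gives g=φ, which is not jump M♮-convex. *)

theory Defs
  imports
    "HOL-Library.Extended_Real"
    "HOL-Library.Function_Algebras"
    "Graph_Theory.Digraph"
begin

text \<open>
  A vector in \<open>\<int>\<^sup>N\<close> is represented by an integer function that vanishes outside \<open>N\<close>.
  Addition, subtraction, negation, the order, and the componentwise minimum \<^const>\<open>inf\<close> and
  maximum \<^const>\<open>sup\<close> are then the pointwise operations on functions.
  A function \<open>\<int>\<^sup>N \<rightarrow> \<real> \<union> {+\<infinity>}\<close> is an \<^typ>\<open>ereal\<close>-valued function whose values outside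
  \<^term>\<open>int_vectors N\<close> play no role.
\<close>

definition int_vectors :: "'i set \<Rightarrow> ('i \<Rightarrow> int) set" where
  "int_vectors N = {x. \<forall>i. i \<notin> N \<longrightarrow> x i = 0}"

definition eff_dom :: "'i set \<Rightarrow> (('i \<Rightarrow> int) \<Rightarrow> ereal) \<Rightarrow> ('i \<Rightarrow> int) set" where
  "eff_dom N f = {x \<in> int_vectors N. f x < \<infinity>}"

definition unit_vector :: "'i \<Rightarrow> 'i \<Rightarrow> int" where
  "unit_vector i = (\<lambda>j. if j = i then 1 else 0)"

definition is_increment ::
    "'i set \<Rightarrow> ('i \<Rightarrow> int) \<Rightarrow> ('i \<Rightarrow> int) \<Rightarrow> ('i \<Rightarrow> int) \<Rightarrow> bool" where
  "is_increment N x y s \<longleftrightarrow>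
     (\<exists>i\<in>N. s = unit_vector i \<or> s = - unit_vector i) \<and> x + s \<in> {inf x y..sup x y}"

definition jump_Mnat_exchange :: "'i set \<Rightarrow> (('i \<Rightarrow> int) \<Rightarrow> ereal) \<Rightarrow> bool" where
  "jump_Mnat_exchange N f \<longleftrightarrow>
     (\<forall>x\<in>eff_dom N f. \<forall>y\<in>eff_dom N f. \<forall>s. is_increment N x y s \<longrightarrow>
        (x + s \<in> eff_dom N f \<and> y - s \<in> eff_dom N f \<and> f x + f y \<ge> f (x + s) + f (y - s)) \<or>
        (\<exists>t. is_increment N (x + s) y t \<and>
             x + s + t \<in> eff_dom N f \<and> y - s - t \<in> eff_dom N f \<and>
             f x + f y \<ge> f (x + s + t) + f (y - s - t)))"

definition jump_Mnat_convex :: "'i set \<Rightarrow> (('i \<Rightarrow> int) \<Rightarrow> ereal) \<Rightarrow> bool" where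
  "jump_Mnat_convex N f \<longleftrightarrow>
     finite N \<and> (\<forall>x\<in>int_vectors N. f x > -\<infinity>) \<and> eff_dom N f \<noteq> {} \<and> jump_Mnat_exchange N f"

text \<open>
  The midpoint inequality alone does not force the effective domain to be an interval of integers
  (it holds for the function that is \<open>0\<close> on \<open>{0, 3}\<close> and \<open>+\<infinity>\<close> elsewhere), so the absence of
  holes, which is part of the usual meaning of convexity, is required separately.
\<close>

definition discrete_convex :: "(int \<Rightarrow> ereal) \<Rightarrow> bool" where
  "discrete_convex \<phi> \<longleftrightarrow>
     (\<forall>t. \<phi> t > -\<infinity>) \<and>
     (\<forall>t. \<phi> (t - 1) + \<phi> (t + 1) \<ge> 2 * \<phi> t) \<and>
     (\<forall>r s t. r \<le> s \<longrightarrow> s \<le> t \<longrightarrow> \<phi> r < \<infinity> \<longrightarrow> \<phi> t < \<infinity> \<longrightarrow> \<phi> s < \<infinity>)"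

definition net_supply :: "('v, 'a) pre_digraph \<Rightarrow> ('a \<Rightarrow> int) \<Rightarrow> 'v \<Rightarrow> int" where
  "net_supply G \<xi> v = (\<Sum>a\<in>out_arcs G v. \<xi> a) - (\<Sum>a\<in>in_arcs G v. \<xi> a)"

definition feasible_flows ::
    "('v, 'a) pre_digraph \<Rightarrow> 'v set \<Rightarrow> 'v set \<Rightarrow> ('v \<Rightarrow> int) \<Rightarrow> (('a \<Rightarrow> int) \<times> ('v \<Rightarrow> int)) set" where
  "feasible_flows G S T y =
     {(\<xi>, x). \<xi> \<in> int_vectors (arcs G) \<and> x \<in> int_vectors S \<and>
        (\<forall>v\<in>S. net_supply G \<xi> v = x v) \<and>
        (\<forall>v\<in>T. net_supply G \<xi> v = - y v) \<and>
        (\<forall>v\<in>verts G - (S \<union> T). net_supply G \<xi> v = 0)}"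

text \<open>The infimum of the empty set in \<^typ>\<open>ereal\<close> is \<open>+\<infinity>\<close>.\<close>

definition network_transform ::
    "('v, 'a) pre_digraph \<Rightarrow> 'v set \<Rightarrow> 'v set \<Rightarrow> ('a \<Rightarrow> int \<Rightarrow> ereal) \<Rightarrow>
     (('v \<Rightarrow> int) \<Rightarrow> ereal) \<Rightarrow> ('v \<Rightarrow> int) \<Rightarrow> ereal" where
  "network_transform G S T \<phi> f y =
     (INF (\<xi>, x)\<in>feasible_flows G S T y. f x + (\<Sum>a\<in>arcs G. \<phi> a (\<xi> a)))"

end

theory Submission
  imports Defs "HOL-Library.Multiset" "HOL-Library.Product_Plus"
begin

text \<open>
  The exchange axiom is brought into a form with only double steps, shown to survive one arc at a
  time, and the infimum is handled at the end.

  Points live in an abelian group with a symmetric set \<open>U\<close> of unit steps, and the difference of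
  two points is written as the sum of a multiset of units that contains no unit together with its
  negative; the increments between the points are then the members of the multiset.
  A real function \<open>h\<close> on a set \<open>D\<close> has the double-step exchange property \<open>jump_M\<close> if moving
  from \<open>x\<close> towards \<open>y\<close> by any member \<open>s\<close> can be completed by a second member \<open>t\<close> with
  \<open>h (x + s + t) + h (y - s - t) \<le> h x + h y\<close>. A jump M-natural-convex function acquires this
  property after adding one coordinate that carries the parity of the coordinate sum
  (\<open>lift_jump_M\<close>): a single step becomes a double step whose second half changes the parity
  coordinate.

  Seen from the vertices, a flow of \<open>k\<close> units along an arc replaces \<open>x\<close> by \<open>x + k e\<close>,
  where \<open>e\<close> is the difference of the unit vectors of head and tail. So the network transform is
  obtained from \<open>f\<close>, extended by \<open>\<infinity>\<close> to all vertices, by one infimal convolution per arc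
  with a convex function on the line spanned by \<open>e\<close>, followed by restriction to vectors that
  vanish outside \<open>T\<close>. On a finite interval such a convolution is a succession of elementary
  ones, each of the form \<open>h' x = min (h x) (h (x - e) + c)\<close> with nondecreasing constants \<open>c\<close>.

  The heart of the proof is that \<open>jump_M\<close> is preserved by the elementary convolution
  (\<open>segment_jump_M\<close>). A direct argument, repeating exchanges until the net change is
  admissible, may run in circles. Instead it is enough to exchange between points at distance 4,
  provided that the domain admits one-sided exchanges (\<open>local_imp_global\<close>).
  At distance 4, if every way to split the four steps into two pairs were too expensive, suitable
  potentials would make every single pair too expensive; the exchange property of \<open>h\<close> then
  produces an infinite strict descent among finitely many values (\<open>four_point_descent\<close>). The
  same descent proves the parity lift.

  The infimum need not be attained. For each \<open>\<epsilon> > 0\<close> the exchange is carried out on nearly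
  optimal flows, with the arc intervals just large enough to contain both; finitely many second
  increments are available, so one of them serves for all \<open>\<epsilon>\<close>.
\<close>

section \<open>Conformal multisets and exchange axioms\<close>


text \<open>
  Multisets of units in which nothing cancels. For signed unit vectors, if \<open>y = x + \<Sum>M\<close> with \<open>M\<close> conformal, then
  \<open>M\<close> lists the unit steps of the shortest paths from \<open>x\<close> to \<open>y\<close>, and the increments from
  \<open>x\<close> towards \<open>y\<close> are the members of \<open>M\<close>.
\<close>

definition conformal :: "'g::ab_group_add set \<Rightarrow> 'g multiset \<Rightarrow> bool" where
  "conformal U M \<longleftrightarrow> set_mset M \<subseteq> U \<and> (\<forall>u\<in>#M. - u \<notin># M)"

text \<open>
  The exchange axiom with double steps only, for a function that is finite on \<open>D\<close> and \<open>\<infinity>\<close>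
  elsewhere. The target is \<open>y = x + s + \<Sum>M\<close>, so that \<open>y - s - t = x + \<Sum>N\<close>
  when \<open>M\<close> consists of \<open>t\<close> and \<open>N\<close>. The case \<open>M = {#}\<close> says that no two points of
  \<open>D\<close> differ by one unit.
\<close>

definition jump_M :: "'g::ab_group_add set \<Rightarrow> 'g set \<Rightarrow> ('g \<Rightarrow> real) \<Rightarrow> bool" where
  "jump_M U D h \<longleftrightarrow>
     (\<forall>x s M. conformal U (add_mset s M) \<longrightarrow> x \<in> D \<longrightarrow> x + s + \<Sum>\<^sub># M \<in> D \<longrightarrow>
        (\<exists>t N. M = add_mset t N \<and> x + s + t \<in> D \<and> x + \<Sum>\<^sub># N \<in> D \<and>
               h (x + s + t) + h (x + \<Sum>\<^sub># N) \<le> h x + h (x + s + \<Sum>\<^sub># M)))"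

text \<open>The one-sided two-step axiom of constant-parity jump systems.\<close>

definition jump_step :: "'g::ab_group_add set \<Rightarrow> 'g set \<Rightarrow> bool" where
  "jump_step U D \<longleftrightarrow>
     (\<forall>x s M. conformal U (add_mset s M) \<longrightarrow> x \<in> D \<longrightarrow> x + s + \<Sum>\<^sub># M \<in> D \<longrightarrow>
        (\<exists>t\<in>#M. x + s + t \<in> D))"

text \<open>
  The exchange axiom for points at distance 4: the four steps split into two pairs that are
  cheap together.
\<close>

definition local_exchange :: "'g::ab_group_add set \<Rightarrow> 'g set \<Rightarrow> ('g \<Rightarrow> real) \<Rightarrow> bool" where
  "local_exchange U D h \<longleftrightarrow>
     (\<forall>x K. conformal U K \<longrightarrow> size K = 4 \<longrightarrow> x \<in> D \<longrightarrow> x + \<Sum>\<^sub># K \<in> D \<longrightarrow>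
        (\<exists>P Q. K = P + Q \<and> size P = 2 \<and> size Q = 2 \<and> x + \<Sum>\<^sub># P \<in> D \<and> x + \<Sum>\<^sub># Q \<in> D \<and>
               h (x + \<Sum>\<^sub># P) + h (x + \<Sum>\<^sub># Q) \<le> h x + h (x + \<Sum>\<^sub># K)))"

lemma conformal_subset: "conformal U M \<Longrightarrow> set_mset N \<subseteq> set_mset M \<Longrightarrow> conformal U N"
  unfolding conformal_def by blast

lemma conformal_uminus:
  assumes "\<And>u. u \<in> U \<Longrightarrow> - u \<in> U" "conformal U M"
  shows "conformal U (image_mset uminus M)"
  using assms unfolding conformal_def by auto

lemma sum_mset_uminus: "\<Sum>\<^sub># (image_mset uminus M) = - \<Sum>\<^sub># (M :: 'g::ab_group_add multiset)"
  by (induction M) auto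

lemma jump_M_imp_jump_step: "jump_M U D h \<Longrightarrow> jump_step U D"
  unfolding jump_M_def jump_step_def by (metis union_single_eq_member)

lemma local_exchangeE:
  assumes "local_exchange U D h" "conformal U {#a, b, c, d#}" "x \<in> D" "x + a + b + c + d \<in> D"
  obtains t where "t \<in># {#b, c, d#}" "x + a + t \<in> D" "x + b + c + d - t \<in> D"
    "h (x + a + t) + h (x + b + c + d - t) \<le> h x + h (x + a + b + c + d)"
proof -
  let ?K = "{#a, b, c, d#}"
  have sumK: "x + \<Sum>\<^sub># ?K = x + a + b + c + d" by (simp add: ac_simps)
  have "size ?K = 4" by simp
  then obtain P0 Q0 where PQ0: "?K = P0 + Q0" "size P0 = 2" "size Q0 = 2"
      "x + \<Sum>\<^sub># P0 \<in> D" "x + \<Sum>\<^sub># Q0 \<in> D"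
      "h (x + \<Sum>\<^sub># P0) + h (x + \<Sum>\<^sub># Q0) \<le> h x + h (x + \<Sum>\<^sub># ?K)"
    using assms unfolding local_exchange_def sumK[symmetric] by blast
  have "a \<in># P0 + Q0" unfolding PQ0(1)[symmetric] by simp
  then have "\<exists>P Q. a \<in># P \<and> ?K = P + Q \<and> size P = 2 \<and> x + \<Sum>\<^sub># P \<in> D \<and> x + \<Sum>\<^sub># Q \<in> D \<and>
      h (x + \<Sum>\<^sub># P) + h (x + \<Sum>\<^sub># Q) \<le> h x + h (x + \<Sum>\<^sub># ?K)"
  proof (cases "a \<in># P0")
    case True
    then show ?thesis using PQ0 by blast
  next
    case False
    then have "a \<in># Q0" using \<open>a \<in># P0 + Q0\<close> by simp
    then show ?thesis
      using PQ0 by (intro exI[of _ Q0] exI[of _ P0]) (simp add: add.commute)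
  qed
  then obtain P Q where PQ: "a \<in># P" "?K = P + Q" "size P = 2" "x + \<Sum>\<^sub># P \<in> D" "x + \<Sum>\<^sub># Q \<in> D"
      "h (x + \<Sum>\<^sub># P) + h (x + \<Sum>\<^sub># Q) \<le> h x + h (x + \<Sum>\<^sub># ?K)" by blast
  obtain P' where P': "P = add_mset a P'" using multi_member_split[OF PQ(1)] by blast
  then have "size P' = 1" using PQ(3) by simp
  then obtain t where t: "P = {#a, t#}" using P' size_1_singleton_mset by metis
  have bcd: "{#b, c, d#} = add_mset t Q" using PQ(2) t by simp
  have "\<Sum>\<^sub># {#b, c, d#} = t + \<Sum>\<^sub># Q" unfolding bcd by simp
  then have Q: "\<Sum>\<^sub># Q = b + c + d - t" by (simp add: algebra_simps)
  show ?thesis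
  proof (rule that[of t])
    show "t \<in># {#b, c, d#}" unfolding bcd by simp
    show "x + a + t \<in> D" using PQ(4) t by (simp add: ac_simps)
    show "x + b + c + d - t \<in> D" using PQ(5) Q by (simp add: algebra_simps)
    show "h (x + a + t) + h (x + b + c + d - t) \<le> h x + h (x + a + b + c + d)"
      using PQ(6) unfolding sumK unfolding t Q by (simp add: algebra_simps)
  qed
qed

section \<open>From local to global exchange\<close>

text \<open>
  By induction on the distance. Suppose that the exchange of \<open>x\<close> and \<open>y\<close> in direction \<open>s\<close>
  fails for all \<open>t\<close>. There are potentials \<open>p t\<close> with
  \<open>h (x + s + t) \<ge> h x + p t\<close> and \<open>h (y - s - t) > h y - p t\<close>. Replace \<open>y\<close> by
  \<open>y' = y - a - b\<close>, the pair \<open>a, b\<close> being chosen outside \<open>s\<close> with minimal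
  \<open>h y' + p a + p b\<close>. The induction hypothesis exchanges \<open>x\<close> and \<open>y'\<close> by some \<open>s + t\<close>,
  and local exchange between \<open>y\<close> and \<open>y' - s - t\<close> then contradicts the choice of \<open>p\<close> or
  that of \<open>a, b\<close>.
\<close>

lemma local_imp_global:
  fixes U :: "'g::ab_group_add set"
  assumes sym: "\<And>u. u \<in> U \<Longrightarrow> - u \<in> U"
    and step: "jump_step U D" and loc: "local_exchange U D h"
  shows "jump_M U D h"
proof -
  have "\<exists>t N. M = add_mset t N \<and> x + s + t \<in> D \<and> x + \<Sum>\<^sub># N \<in> D \<and>
               h (x + s + t) + h (x + \<Sum>\<^sub># N) \<le> h x + h (x + s + \<Sum>\<^sub># M)"
    if "conformal U (add_mset s M)" "x \<in> D" "x + s + \<Sum>\<^sub># M \<in> D" for x s M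
    using that
  proof (induction "size M" arbitrary: M rule: less_induct)
    case less
    define y where "y = x + s + \<Sum>\<^sub># M"
    have yD: "y \<in> D" using less.prems y_def by simp
    obtain t0 where t0: "t0 \<in># M" "x + s + t0 \<in> D"
      using step less.prems unfolding jump_step_def by blast
    obtain M1 where M1: "M = add_mset t0 M1"
      using multi_member_split[OF t0(1)] by blast
    show ?case
    proof (cases "M1 = {#}")
      case True
      then show ?thesis using M1 t0 less.prems by (intro exI[of _ t0] exI[of _ "{#}"]) auto
    next
      case False
      then obtain sg M2 where M2: "M1 = add_mset sg M2" by (meson multiset_cases)
      have cM2: "conformal U (image_mset uminus (add_mset sg M2))"
        by (rule conformal_uminus[OF sym]) (auto intro: conformal_subset[OF less.prems(1)] simp: M1 M2)
      have "y + - sg + \<Sum>\<^sub># (image_mset uminus M2) = x + s + t0"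
        by (simp add: sum_mset_uminus y_def M1 M2 algebra_simps)
      then have "\<exists>t\<in>#image_mset uminus M2. y + - sg + t \<in> D"
        using step cM2 yD t0 unfolding jump_step_def by (metis image_mset_add_mset)
      then obtain tau M3 where tau: "M2 = add_mset tau M3" "y - sg - tau \<in> D"
        by (auto dest!: multi_member_split)
      \<comment> \<open>the 1 only makes the second inequality strict when the first one is void\<close>
      define p where "p = (\<lambda>t. if x + s + t \<in> D then h (x + s + t) - h x
          else if y - s - t \<in> D then h y - h (y - s - t) + 1 else 0)"
      show ?thesis
      proof (rule ccontr)
        assume neg: "\<not> ?thesis"
        have fail: "h (x + s + t) + h (y - s - t) > h x + h y"
          if "t \<in># M" "x + s + t \<in> D" "y - s - t \<in> D" for t
        proof -
          obtain N where N: "M = add_mset t N" using \<open>t \<in># M\<close> by (auto dest: multi_member_split)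
          have "y - s - t = x + \<Sum>\<^sub># N" by (simp add: y_def N algebra_simps)
          then show ?thesis using neg N that unfolding y_def by (metis linorder_not_le)
        qed
        have A1: "h (x + s + t) \<ge> h x + p t" if "x + s + t \<in> D" for t
          using that by (simp add: p_def)
        have A2: "h (y - s - t) > h y - p t" if "t \<in># M" "y - s - t \<in> D" for t
          using that fail[of t] by (auto simp: p_def)
        define Q where "Q = {(a, b). a \<in># M \<and> b \<in># M \<and> (\<exists>N. M = add_mset a (add_mset b N)) \<and> y - a - b \<in> D}"
        have "finite Q" by (rule finite_subset[of _ "set_mset M \<times> set_mset M"]) (auto simp: Q_def)
        have "(sg, tau) \<in> Q" using tau M1 M2 unfolding Q_def
          by (auto intro!: exI[of _ "add_mset t0 M3"])
        define val where "val = (\<lambda>(a, b). h (y - a - b) + p a + p b)"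
        obtain q where q: "q \<in> Q" "\<And>q'. q' \<in> Q \<Longrightarrow> val q \<le> val q'"
          using ex_is_arg_min_if_finite[OF \<open>finite Q\<close>, of val] \<open>(sg, tau) \<in> Q\<close>
          by (auto simp: is_arg_min_linorder)
        obtain a b where ab: "q = (a, b)" by (cases q)
        obtain N where N: "M = add_mset a (add_mset b N)" using q(1) ab by (auto simp: Q_def)
        have abD: "y - a - b \<in> D" using q(1) ab by (auto simp: Q_def)
        have minab: "h (y - a - b) + p a + p b \<le> h (y - c - d) + p c + p d"
          if "M = add_mset c (add_mset d N')" "y - c - d \<in> D" for c d N'
          using q(2)[of "(c, d)"] that ab by (auto simp: Q_def val_def)
        have y': "x + s + \<Sum>\<^sub># N = y - a - b" by (simp add: y_def N algebra_simps)
        have cN: "conformal U (add_mset s N)"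
          by (rule conformal_subset[OF less.prems(1)]) (auto simp: N)
        obtain t N' where t: "N = add_mset t N'" "x + s + t \<in> D" "x + \<Sum>\<^sub># N' \<in> D"
          "h (x + s + t) + h (x + \<Sum>\<^sub># N') \<le> h x + h (y - a - b)"
          using less.hyps[of N] cN less.prems(2) abD y' N by auto
        have tM: "t \<in># M" "a \<in># M" "b \<in># M" by (auto simp: N t)
        define w where "w = x + \<Sum>\<^sub># N'"
        have w: "w = y - s - t - a - b" by (simp add: y_def N t w_def algebra_simps)
        have lew: "h w \<le> h (y - a - b) - p t" using t(4) A1[OF t(2)] w_def by simp
        have c4: "conformal U {#- s, - t, - a, - b#}"
          using conformal_uminus[OF sym conformal_subset[OF less.prems(1), of "{#s,t,a,b#}"]]
          by (auto simp: N t)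
        have w2: "y + - s + - t + - a + - b = w" by (simp add: w algebra_simps)
        have wD: "y + - s + - t + - a + - b \<in> D" unfolding w2 using t(3) w_def by simp
        obtain r where r: "r \<in># {#- t, - a, - b#}" "y + - s + r \<in> D" "y + - t + - a + - b - r \<in> D"
          "h (y + - s + r) + h (y + - t + - a + - b - r) \<le> h y + h (y + - s + - t + - a + - b)"
          by (rule local_exchangeE[OF loc c4 yD wD]) blast
        \<comment> \<open>the partner of \<open>- s\<close> in the local exchange between \<open>y\<close> and \<open>w\<close>\<close>
        consider "r = - t" | "r = - a" | "r = - b" using r(1) by auto
        then show False
        proof cases
          case 1
          have "h (y - s - t) > h y - p t" using A2[OF tM(1)] r(2) 1 by (simp add: algebra_simps)
          moreover have "h (y - s - t) + h (y - a - b) \<le> h y + h w"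
            using r(4) unfolding w2 unfolding 1 by (simp add: algebra_simps)
          ultimately show False using lew by simp
        next
          case 2
          have "h (y - s - a) > h y - p a" using A2[OF tM(2)] r(2) 2 by (simp add: algebra_simps)
          moreover have "h (y - s - a) + h (y - t - b) \<le> h y + h w"
            using r(4) unfolding w2 unfolding 2 by (simp add: algebra_simps)
          moreover have "h (y - a - b) + p a + p b \<le> h (y - t - b) + p t + p b"
            by (rule minab[of t b "add_mset a N'"]) (use r(3) 2 in \<open>auto simp: N t algebra_simps\<close>)
          ultimately show False using lew by simp
        next
          case 3
          have "h (y - s - b) > h y - p b" using A2[OF tM(3)] r(2) 3 by (simp add: algebra_simps)
          moreover have "h (y - s - b) + h (y - t - a) \<le> h y + h w"
            using r(4) unfolding w2 unfolding 3 by (simp add: algebra_simps)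
          moreover have "h (y - a - b) + p a + p b \<le> h (y - t - a) + p t + p a"
            by (rule minab[of t a "add_mset b N'"]) (use r(3) 3 in \<open>auto simp: N t algebra_simps\<close>)
          ultimately show False using lew by simp
        qed
      qed
    qed
  qed
  then show ?thesis unfolding jump_M_def by blast
qed

section \<open>A descent on four points\<close>

lemma separate_finite_sets:
  fixes X Y :: "real set"
  assumes "finite X" "finite Y" and "\<And>x y. x \<in> X \<Longrightarrow> y \<in> Y \<Longrightarrow> x + y > V"
  obtains q where "\<And>x. x \<in> X \<Longrightarrow> x > q" "\<And>y. y \<in> Y \<Longrightarrow> y > V - q"
proof (cases "X = {} \<or> Y = {}")
  case True
  then show ?thesis
  proof
    assume X: "X = {}"
    have "bdd_below Y" using assms(2) by simp
    then obtain m where "\<And>y. y \<in> Y \<Longrightarrow> m \<le> y" by (auto simp: bdd_below_def)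
    then show ?thesis using X by (intro that[of "V - m + 1"]) force+
  next
    assume Y: "Y = {}"
    have "bdd_below X" using assms(1) by simp
    then obtain m where "\<And>x. x \<in> X \<Longrightarrow> m \<le> x" by (auto simp: bdd_below_def)
    then show ?thesis using Y by (intro that[of "m - 1"]) force+
  qed
next
  case False
  have "Min X + Min Y > V" using False assms by simp
  then have "Min X > (Min X + V - Min Y) / 2" "Min Y > V - (Min X + V - Min Y) / 2"
    by (simp_all add: field_simps)
  moreover have "x \<ge> Min X" if "x \<in> X" for x using that assms by simp
  moreover have "y \<ge> Min Y" if "y \<in> Y" for y using that assms by simp
  ultimately show ?thesis by (intro that[of "(Min X + V - Min Y) / 2"]) fastforce+
qed

text \<open>
  \<open>g P\<close> collects the values of \<open>h\<close> reached from a point of value \<open>\<alpha>\<close> by the pair of steps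
  \<open>P\<close>, and \<open>\<omega>\<close> is the value at the end of all four steps; by \<open>pairs\<close> no splitting into two
  pairs is cheap. The numbers \<open>a i\<close> and \<open>b i\<close> are values of intermediate points where step
  \<open>i\<close> alone has been made, respectively where it alone is missing. There are potentials
  \<open>r i\<close> with sum \<open>\<omega> - \<alpha>\<close> such that every value in \<open>g {i, j}\<close> exceeds
  \<open>\<alpha> + r i + r j\<close>. Rule \<open>A\<close> followed by rule \<open>B\<close> then strictly lowers \<open>a i - r i\<close>, which
  cannot go on in a finite set.
\<close>

lemma four_point_descent:
  fixes I :: "nat set" and g :: "nat set \<Rightarrow> real set" and a b :: "nat \<Rightarrow> real"
  assumes card: "card I = 4"
    and fin: "\<And>P. finite (g P)"
    and pairs: "\<And>P x y. P \<subseteq> I \<Longrightarrow> card P = 2 \<Longrightarrow> x \<in> g P \<Longrightarrow> y \<in> g (I - P) \<Longrightarrow> x + y > \<alpha> + \<omega>"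
    and B: "\<And>i. i \<in> DB \<Longrightarrow> \<exists>j\<in>DA. i \<in> I \<and> j \<in> I \<and> i \<noteq> j \<and> (\<exists>x\<in>g (I - {i, j}). a j + x \<le> b i + \<alpha>)"
    and A: "\<And>i. i \<in> DA \<Longrightarrow> \<exists>j\<in>DB. i \<in> I \<and> j \<in> I \<and> i \<noteq> j \<and> (\<exists>x\<in>g {i, j}. b j + x \<le> a i + \<omega>)"
  shows "DA = {}"
proof (rule ccontr)
  assume "DA \<noteq> {}"
  have finI: "finite I" using card by (auto intro: card_ge_0_finite)
  obtain i1 i2 i3 i4 where I: "I = {i1, i2, i3, i4}" and dist: "distinct [i1, i2, i3, i4]"
  proof -
    from finI card obtain xs where "set xs = I" "distinct xs" "length xs = 4"
      by (metis distinct_card finite_distinct_list)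
    then show ?thesis using that
      by (auto simp: length_Suc_conv eval_nat_numeral)
  qed
  have "\<exists>q. (\<forall>x\<in>g P. x > q) \<and> (\<forall>y\<in>g (I - P). y > \<alpha> + \<omega> - q)" if "P \<subseteq> I" "card P = 2" for P
    using separate_finite_sets[of "g P" "g (I - P)" "\<alpha> + \<omega>"] fin pairs[OF that] by metis
  then obtain q where q: "\<And>P x. P \<subseteq> I \<Longrightarrow> card P = 2 \<Longrightarrow> x \<in> g P \<Longrightarrow> x > q P"
    and q': "\<And>P y. P \<subseteq> I \<Longrightarrow> card P = 2 \<Longrightarrow> y \<in> g (I - P) \<Longrightarrow> y > \<alpha> + \<omega> - q P"
    by metis
  define p12 p13 p14 where "p12 = q {i1, i2} - \<alpha>" and "p13 = q {i1, i3} - \<alpha>" and "p14 = q {i1, i4} - \<alpha>"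
  define \<Delta> where "\<Delta> = \<omega> - \<alpha>"
  \<comment> \<open>\<open>r\<close> solves \<open>r i1 + r j = p1j\<close> for the three indices \<open>j \<noteq> i1\<close>, with total \<open>\<Delta>\<close>\<close>
  define r1 where "r1 = (p12 + p13 + p14 - \<Delta>) / 2"
  define r where "r = (\<lambda>i. if i = i1 then r1 else if i = i2 then p12 - r1
      else if i = i3 then p13 - r1 else p14 - r1)"
  have r: "r i1 = r1" "r i2 = p12 - r1" "r i3 = p13 - r1" "r i4 = p14 - r1"
    using dist by (auto simp: r_def)
  have rsum: "(\<Sum>i\<in>I. r i) = \<Delta>" using dist unfolding I by (simp add: r) (simp add: r1_def field_simps)
  have co: "I - {i1, i2} = {i3, i4}" "I - {i1, i3} = {i2, i4}" "I - {i1, i4} = {i2, i3}"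
    using dist unfolding I by auto
  have gr: "x > \<alpha> + r i + r j" if "i \<in> I" "j \<in> I" "i \<noteq> j" "x \<in> g {i, j}" for i j x
  proof -
    have sub: "{i1, i2} \<subseteq> I" "{i1, i3} \<subseteq> I" "{i1, i4} \<subseteq> I" unfolding I by auto
    have cd: "card {i1, i2} = 2" "card {i1, i3} = 2" "card {i1, i4} = 2" using dist by auto
    have 1: "y > \<alpha> + p12" if "y \<in> g {i1, i2}" for y
      using q[OF sub(1) cd(1) that] by (simp add: p12_def)
    have 2: "y > \<alpha> + p13" if "y \<in> g {i1, i3}" for y
      using q[OF sub(2) cd(2) that] by (simp add: p13_def)
    have 3: "y > \<alpha> + p14" if "y \<in> g {i1, i4}" for y
      using q[OF sub(3) cd(3) that] by (simp add: p14_def)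
    have 4: "y > \<omega> - p12" if "y \<in> g {i3, i4}" for y
      using q'[OF sub(1) cd(1), unfolded co, OF that] by (simp add: p12_def)
    have 5: "y > \<omega> - p13" if "y \<in> g {i2, i4}" for y
      using q'[OF sub(2) cd(2), unfolded co, OF that] by (simp add: p13_def)
    have 6: "y > \<omega> - p14" if "y \<in> g {i2, i3}" for y
      using q'[OF sub(3) cd(3), unfolded co, OF that] by (simp add: p14_def)
    have "r2 + r3 = \<Delta> - p14 \<and> r2 + r4 = \<Delta> - p13 \<and> r3 + r4 = \<Delta> - p12"
      if "r2 = p12 - r1" "r3 = p13 - r1" "r4 = p14 - r1" for r2 r3 r4
      using that by (simp add: r1_def field_simps)
    then have rr: "r i2 + r i3 = \<Delta> - p14" "r i2 + r i4 = \<Delta> - p13" "r i3 + r i4 = \<Delta> - p12"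
      using r by auto
    have swap: "{i2, i1} = {i1, i2}" "{i3, i1} = {i1, i3}" "{i4, i1} = {i1, i4}"
      "{i3, i2} = {i2, i3}" "{i4, i2} = {i2, i4}" "{i4, i3} = {i3, i4}" by auto
    from that(1-3) consider "i = i1" "j = i2" | "i = i1" "j = i3" | "i = i1" "j = i4"
      | "i = i2" "j = i1" | "i = i2" "j = i3" | "i = i2" "j = i4"
      | "i = i3" "j = i1" | "i = i3" "j = i2" | "i = i3" "j = i4"
      | "i = i4" "j = i1" | "i = i4" "j = i2" | "i = i4" "j = i3"
      unfolding I by auto
    then show ?thesis
      using that(4) rr r 1[of x] 2[of x] 3[of x] 4[of x] 5[of x] 6[of x]
      by cases (simp_all add: swap \<Delta>_def)
  qed
  have grc: "x > \<omega> - r i - r j" if "i \<in> I" "j \<in> I" "i \<noteq> j" "x \<in> g (I - {i, j})" for i j x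
  proof -
    have "card (I - {i, j}) = 2" using that finI card by (simp add: card_Diff_subset)
    then obtain k l where kl: "I - {i, j} = {k, l}" "k \<noteq> l" by (auto simp: card_2_iff)
    have "(\<Sum>i\<in>I. r i) = r i + r j + (\<Sum>i\<in>I - {i, j}. r i)"
      using that finI by (subst sum.subset_diff[of "{i, j}" I]) auto
    then have "r k + r l = \<Delta> - r i - r j" using rsum kl by simp
    moreover have "k \<in> I" "l \<in> I" using kl by auto
    ultimately show ?thesis using gr[of k l x] that kl by (simp add: \<Delta>_def)
  qed
  have down: "\<exists>k\<in>DA. a k - r k < a i - r i" if i: "i \<in> DA" for i
  proof -
    obtain j x where j: "j \<in> DB" "i \<in> I" "j \<in> I" "i \<noteq> j" "x \<in> g {i, j}" "b j + x \<le> a i + \<omega>"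
      using A[OF i] by blast
    obtain k y where k: "k \<in> DA" "k \<in> I" "j \<noteq> k" "y \<in> g (I - {j, k})" "a k + y \<le> b j + \<alpha>"
      using B[OF j(1)] by blast
    have "a k - r k < a i - r i"
      using gr[OF j(2,3,4,5)] grc[OF j(3) k(2,3,4)] j(6) k(5) by linarith
    then show ?thesis using k(1) by blast
  qed
  have "DA \<subseteq> I" using A by blast
  then have "finite DA" using finI finite_subset by blast
  then obtain i where "i \<in> DA" "\<And>k. k \<in> DA \<Longrightarrow> \<not> a k - r k < a i - r i"
    using ex_is_arg_min_if_finite[of DA "\<lambda>k. a k - r k"] \<open>DA \<noteq> {}\<close>
    by (auto simp: is_arg_min_def)
  then show False using down by blast
qed

section \<open>Convolution with a segment\<close>

text \<open>The exchange property with the steps indexed by a finite set, needed where the same unit may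
  occur several times and the occurrences have to be told apart.\<close>

lemma jump_M_indexed:
  assumes "jump_M U D h" "finite I" "conformal U (add_mset s (image_mset u (mset_set I)))"
    and "x \<in> D" "x + s + sum u I \<in> D"
  obtains j where "j \<in> I" "x + s + u j \<in> D" "x + sum u (I - {j}) \<in> D"
    "h (x + s + u j) + h (x + sum u (I - {j})) \<le> h x + h (x + s + sum u I)"
proof -
  have sm: "\<Sum>\<^sub># (image_mset u (mset_set I)) = sum u I" by (simp add: sum_unfold_sum_mset)
  obtain t N where tN: "image_mset u (mset_set I) = add_mset t N" "x + s + t \<in> D" "x + \<Sum>\<^sub># N \<in> D"
    "h (x + s + t) + h (x + \<Sum>\<^sub># N) \<le> h x + h (x + s + sum u I)"
    using assms unfolding jump_M_def sm[symmetric] by blast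
  have "t \<in># image_mset u (mset_set I)" unfolding tN(1) by simp
  then obtain j where j: "j \<in> I" "t = u j" using assms(2) by auto
  have "sum u I = t + \<Sum>\<^sub># N" using sm unfolding tN(1) by simp
  then have "\<Sum>\<^sub># N = sum u (I - {j})" using j assms(2) by (simp add: sum_diff1)
  then show ?thesis using that[of j] j tN(2-4) by simp
qed

lemma jump_M_imp_local_exchange:
  assumes "jump_M U D h"
  shows "local_exchange U D h"
  unfolding local_exchange_def
proof (intro allI impI)
  fix x K
  assume *: "conformal U K" "size K = 4" "x \<in> D" "x + \<Sum>\<^sub># K \<in> D"
  then have "K \<noteq> {#}" by auto
  then obtain s M where K: "K = add_mset s M" by (meson multiset_cases)
  have eq: "x + s + \<Sum>\<^sub># M = x + \<Sum>\<^sub># K" by (simp add: K add.assoc)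
  obtain t N where tN: "M = add_mset t N" "x + s + t \<in> D" "x + \<Sum>\<^sub># N \<in> D"
    "h (x + s + t) + h (x + \<Sum>\<^sub># N) \<le> h x + h (x + s + \<Sum>\<^sub># M)"
    using assms *(1,3,4) unfolding jump_M_def eq[symmetric] unfolding K by blast
  have "x + s + t = x + \<Sum>\<^sub># {#s, t#}" by (simp add: add.assoc)
  moreover have "K = {#s, t#} + N" "size {#s, t#} = 2" "size N = 2" using K tN(1) *(2) by auto
  ultimately show "\<exists>P Q. K = P + Q \<and> size P = 2 \<and> size Q = 2 \<and> x + \<Sum>\<^sub># P \<in> D \<and> x + \<Sum>\<^sub># Q \<in> D \<and>
      h (x + \<Sum>\<^sub># P) + h (x + \<Sum>\<^sub># Q) \<le> h x + h (x + \<Sum>\<^sub># K)"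
    using tN(2-4) unfolding eq by metis
qed

lemma mset_indexed:
  obtains u :: "nat \<Rightarrow> 'a" where "K = image_mset u (mset_set {0..<size K})"
proof -
  obtain xs where xs: "K = mset xs" by (metis ex_mset)
  then have "K = image_mset ((!) xs) (mset_set {0..<size K})"
    by (metis map_nth mset_map mset_upt size_mset)
  then show ?thesis by (rule that)
qed

text \<open>How two further units \<open>A\<close> and \<open>B\<close> can interact with a conformal multiset: each may extend
  it or cancel one of its members.\<close>

lemma conformal_cancel_cases:
  assumes "conformal U K" "A \<in> U" "B \<in> U" "A \<noteq> - B" "A \<noteq> - A" "B \<noteq> - B"
  obtains (neither) "conformal U (add_mset A (add_mset B K))"
    | (left) K' where "K = add_mset (- A) K'" "conformal U (add_mset B K')"
    | (right) K' where "K = add_mset (- B) K'" "conformal U (add_mset A K')"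
    | (both) K' where "K = add_mset (- A) (add_mset (- B) K')"
proof (cases "- A \<in># K")
  case True
  then obtain K' where K': "K = add_mset (- A) K'" by (auto dest: multi_member_split)
  show ?thesis
  proof (cases "- B \<in># K'")
    case True
    then obtain K'' where "K' = add_mset (- B) K''" by (auto dest: multi_member_split)
    then show ?thesis using K' both by simp
  next
    case False
    have "conformal U (add_mset B K')"
      using assms False unfolding conformal_def K'
      by auto
    then show ?thesis using K' left by blast
  qed
next
  case A: False
  show ?thesis
  proof (cases "- B \<in># K")
    case True
    then obtain K' where K': "K = add_mset (- B) K'" by (auto dest: multi_member_split)
    have "conformal U (add_mset A K')"
      using assms A unfolding conformal_def K' by auto
    then show ?thesis using K' right by blast
  next
    case False
    have "- B \<noteq> A" "- A \<noteq> B" using assms(4) by auto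
    moreover have "\<forall>u\<in>#K. - u \<noteq> A \<and> - u \<noteq> B" using A False by auto
    ultimately have "conformal U (add_mset A (add_mset B K))"
      using assms A False unfolding conformal_def by auto
    then show ?thesis by (rule neither)
  qed
qed

text \<open>
  One-sided exchange for \<open>D \<union> (D + e)\<close>, \<open>e = A + B\<close>, between points that are represented
  with different shifts. If a step from \<open>z\<close> is answered by \<open>A\<close> or \<open>B\<close>, a further step in
  the other one of these directions completes the shift by \<open>e\<close>.
\<close>

lemma segment_step_core:
  fixes U :: "'g::ab_group_add set"
  assumes step: "jump_step U D" and units: "A \<in> U" "B \<in> U" "A \<noteq> - B" "A \<noteq> - A" "B \<noteq> - B"
    and conf: "conformal U (add_mset s M)"
    and z: "z \<in> D" and w: "z + s + \<Sum>\<^sub># M + (A + B) \<in> D"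
  shows "\<exists>t\<in>#M. z + s + t \<in> D \<or> z + s + t + (A + B) \<in> D"
proof -
  have stepD: "\<exists>t\<in>#N. x + r + t \<in> D"
    if "conformal U (add_mset r N)" "x \<in> D" "x + r + \<Sum>\<^sub># N \<in> D" for x r N
    using step that unfolding jump_step_def by blast
  have one: ?thesis
    if AB: "A + B = A' + B'" and K: "add_mset s M = add_mset (- A') K'"
      and c: "conformal U (add_mset B' K')" for A' B' K'
  proof -
    from K consider "s = - A'" "M = K'"
      | M' where "M = add_mset (- A') M'" "K' = add_mset s M'"
      by (auto simp: add_eq_conv_ex)
    then show ?thesis
    proof cases
      case 1
      have "z + B' + \<Sum>\<^sub># M \<in> D" using w unfolding AB 1 by (simp add: algebra_simps)
      then obtain t where "t \<in># M" "z + B' + t \<in> D" using stepD c z 1 by blast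
      then show ?thesis unfolding AB using 1 by (intro bexI[of _ t]) (auto simp: algebra_simps)
    next
      case 2
      have "z + s + \<Sum>\<^sub># (add_mset B' M') \<in> D" using w unfolding AB 2 by (simp add: algebra_simps)
      moreover have "conformal U (add_mset s (add_mset B' M'))"
        by (rule conformal_subset[OF c]) (auto simp: 2)
      ultimately obtain t where t: "t \<in># add_mset B' M'" "z + s + t \<in> D" using stepD z by blast
      show ?thesis
      proof (cases "t \<in># M'")
        case True
        then show ?thesis using t 2 by auto
      next
        case False
        then have "z + s + B' \<in> D" using t by auto
        then have "z + s + - A' + (A' + B') \<in> D" by (simp add: algebra_simps)
        then show ?thesis unfolding AB using 2 by auto
      qed
    qed
  qed
  from conf units show ?thesis
  proof (cases rule: conformal_cancel_cases)
    case neither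
    have "z + s + \<Sum>\<^sub># (add_mset A (add_mset B M)) \<in> D" using w by (simp add: algebra_simps)
    moreover have "conformal U (add_mset s (add_mset A (add_mset B M)))"
      by (rule conformal_subset[OF neither]) auto
    ultimately obtain t where t: "t \<in># add_mset A (add_mset B M)" "z + s + t \<in> D"
      using stepD z by blast
    have two: ?thesis if AB: "A + B = A' + B'" and c: "conformal U (add_mset B' M)" "z + s + A' \<in> D"
      for A' B'
    proof -
      have "z + s + A' + B' + \<Sum>\<^sub># M \<in> D" using w unfolding AB by (simp add: algebra_simps)
      then obtain t where "t \<in># M" "z + s + A' + B' + t \<in> D" using stepD c by blast
      then show ?thesis unfolding AB by (intro bexI[of _ t]) (auto simp: algebra_simps)
    qed
    have cA: "conformal U (add_mset A M)" and cB: "conformal U (add_mset B M)"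
      by (rule conformal_subset[OF neither], force)+
    consider "t \<in># M" | "t = A" | "t = B" using t by auto
    then show ?thesis
    proof cases
      case 1
      then show ?thesis using t by auto
    next
      case 2
      then show ?thesis using two[of A B] cB t by simp
    next
      case 3
      then show ?thesis using two[of B A] cA t by (simp add: add.commute)
    qed
  next
    case (left K')
    then show ?thesis using one[of A B] by simp
  next
    case (right K')
    then show ?thesis using one[of B A] by (simp add: add.commute)
  next
    case (both K')
    then consider "s = - A" "M = add_mset (- B) K'" | "s = - B" "M = add_mset (- A) K'"
      | M' where "M = add_mset (- A) (add_mset (- B) M')" "K' = add_mset s M'"
      by (auto simp: add_eq_conv_ex)
    then show ?thesis
    proof cases
      case 1
      then show ?thesis using z by (intro bexI[of _ "- B"]) (auto simp: algebra_simps)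
    next
      case 2
      then show ?thesis using z by (intro bexI[of _ "- A"]) (auto simp: algebra_simps)
    next
      case 3
      have "z + s + \<Sum>\<^sub># M' \<in> D" using w unfolding 3 by (simp add: algebra_simps)
      moreover have "conformal U (add_mset s M')"
        by (rule conformal_subset[OF conf]) (auto simp: 3)
      ultimately show ?thesis using stepD z unfolding 3 by fastforce
    qed
  qed
qed

text \<open>
  Local exchange between differently shifted points. \<open>val P\<close> contains the value after the pair of
  steps \<open>P\<close> from \<open>z\<close>, and the value after the additional shift by \<open>e = A + B\<close>, which costs
  \<open>c\<close>. When one of \<open>A\<close>, \<open>B\<close> cancels a step of \<open>K\<close>, a single exchange or none suffices.
  Otherwise the intermediate points of the descent are those where \<open>A\<close> has been added but
  \<open>B\<close> has not.
\<close>

lemma segment_local_core: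
  fixes U :: "'g::ab_group_add set" and c :: real
  assumes J: "jump_M U D h" and units: "A \<in> U" "B \<in> U" "A \<noteq> - B" "A \<noteq> - A" "B \<noteq> - B"
    and conf: "conformal U K" and size: "size K = 4"
    and z: "z \<in> D" and w: "z + \<Sum>\<^sub># K + (A + B) \<in> D"
  defines "val \<equiv> \<lambda>P. h ` (D \<inter> {z + \<Sum>\<^sub># P}) \<union> (\<lambda>v. h v + c) ` (D \<inter> {z + \<Sum>\<^sub># P + (A + B)})"
  shows "\<exists>P Q. K = P + Q \<and> size P = 2 \<and> size Q = 2 \<and>
    (\<exists>p\<in>val P. \<exists>q\<in>val Q. p + q \<le> h z + h (z + \<Sum>\<^sub># K + (A + B)) + c)"
proof (rule ccontr)
  assume neg: "\<not> ?thesis"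
  let ?w = "z + \<Sum>\<^sub># K + (A + B)"
  define \<omega> where "\<omega> = h ?w + c"
  have fail: False
    if "K = P + Q" "size P = 2" "size Q = 2" "p \<in> val P" "q \<in> val Q" "p + q \<le> h z + \<omega>" for P Q p q
  proof -
    have "p + q \<le> h z + h ?w + c" using that(6) \<omega>_def by simp
    then show False using neg that(1-5) by blast
  qed
  have exc: "\<exists>t N. M = add_mset t N \<and> x + s + t \<in> D \<and> x + \<Sum>\<^sub># N \<in> D \<and>
               h (x + s + t) + h (x + \<Sum>\<^sub># N) \<le> h x + h (x + s + \<Sum>\<^sub># M)"
    if "conformal U (add_mset s M)" "x \<in> D" "x + s + \<Sum>\<^sub># M \<in> D" for x s M
    using J that unfolding jump_M_def by blast
  have val0: "h (z + \<Sum>\<^sub># P) \<in> val P" if "z + \<Sum>\<^sub># P \<in> D" for P using that by (auto simp: val_def)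
  have val1: "h v + c \<in> val P" if "v \<in> D" "v = z + \<Sum>\<^sub># P + (A + B)" for P v using that by (auto simp: val_def)
  have one: False if AB: "A + B = A' + B'" and K: "K = add_mset (- A') K'"
      and c: "conformal U (add_mset B' K')" for A' B' K'
  proof -
    have weq: "?w = z + B' + \<Sum>\<^sub># K'" unfolding AB K by (simp add: algebra_simps)
    obtain t N where tN: "K' = add_mset t N" "z + B' + t \<in> D" "z + \<Sum>\<^sub># N \<in> D"
      "h (z + B' + t) + h (z + \<Sum>\<^sub># N) \<le> h z + h ?w"
      using exc[OF c z] w unfolding weq by blast
    have "h (z + B' + t) + c \<in> val {#- A', t#}"
      by (rule val1[OF tN(2)]) (simp add: AB algebra_simps)
    moreover have "h (z + \<Sum>\<^sub># N) \<in> val N" using val0 tN by blast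
    ultimately show False using fail[of "{#- A', t#}" N] tN(1,4) K size unfolding \<omega>_def by force
  qed
  from conf units show False
  proof (cases rule: conformal_cancel_cases)
    case (left K')
    then show False using one[of A B K'] by simp
  next
    case (right K')
    then show False using one[of B A K'] by (simp add: add.commute)
  next
    case (both K')
    have weq: "?w = z + \<Sum>\<^sub># K'" unfolding both by (simp add: algebra_simps)
    have "h z + c \<in> val {#- A, - B#}" by (rule val1[OF z]) (simp add: algebra_simps)
    moreover have "h ?w \<in> val K'" using val0 w unfolding weq by blast
    ultimately show False using fail[of "{#- A, - B#}" K'] both size unfolding \<omega>_def by force
  next
    case neither
    obtain u :: "nat \<Rightarrow> 'g" where u: "K = image_mset u (mset_set {0..<4})"
      using mset_indexed[of K] unfolding size by metis
    define I where "I = {0..<4::nat}"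
    have finI: "finite I" and cardI: "card I = 4" by (simp_all add: I_def)
    have uI: "K = image_mset u (mset_set I)" using u I_def by simp
    have sumK: "\<Sum>\<^sub># K = sum u I" by (simp add: uI sum_unfold_sum_mset)
    define S where "S = (\<lambda>P. image_mset u (mset_set P))"
    have sumS: "\<Sum>\<^sub># (S P) = sum u P" for P by (simp add: S_def sum_unfold_sum_mset)
    define DA where "DA = {i \<in> I. z + A + u i \<in> D}"
    define DB where "DB = {i \<in> I. z + A + sum u (I - {i}) \<in> D}"
    have confS: "conformal U (add_mset X (S P))" if "P \<subseteq> I" "X = A \<or> X = B" for X P
    proof (rule conformal_subset[OF neither])
      have "finite P" using that finI finite_subset by blast
      then show "set_mset (add_mset X (S P)) \<subseteq> set_mset (add_mset A (add_mset B K))"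
        using that finI by (auto simp: S_def uI)
    qed
    have "DA = {}"
    proof (rule four_point_descent[where g = "\<lambda>P. val (S P)" and I = I and \<alpha> = "h z" and \<omega> = \<omega>
          and a = "\<lambda>i. h (z + A + u i)" and b = "\<lambda>i. h (z + A + sum u (I - {i}))" and DB = DB])
      show "card I = 4" by (rule cardI)
      show "finite (val (S P))" for P by (simp add: val_def)
      show "x + y > h z + \<omega>" if "P \<subseteq> I" "card P = 2" "x \<in> val (S P)" "y \<in> val (S (I - P))" for P x y
      proof (rule ccontr)
        assume le: "\<not> x + y > h z + \<omega>"
        have finP: "finite P" using that finI finite_subset by blast
        have "mset_set I = mset_set P + mset_set (I - P)"
          using that finI finP by (metis Diff_disjoint Diff_partition finite_Diff mset_set_Union)
        then have "K = S P + S (I - P)" by (simp add: S_def uI)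
        moreover have "card (I - P) = 2" using that cardI finP by (simp add: card_Diff_subset)
        ultimately show False using fail[of "S P" "S (I - P)" x y] that le by (simp add: S_def)
      qed
      show "\<exists>j\<in>DA. i \<in> I \<and> j \<in> I \<and> i \<noteq> j \<and>
          (\<exists>x\<in>val (S (I - {i, j})). h (z + A + u j) + x \<le> h (z + A + sum u (I - {i})) + h z)"
        if "i \<in> DB" for i
      proof -
        have i: "i \<in> I" "z + A + sum u (I - {i}) \<in> D" using that by (auto simp: DB_def)
        obtain j where j: "j \<in> I - {i}" "z + A + u j \<in> D" "z + sum u (I - {i} - {j}) \<in> D"
          "h (z + A + u j) + h (z + sum u (I - {i} - {j})) \<le> h z + h (z + A + sum u (I - {i}))"
        proof (rule jump_M_indexed[OF J, of "I - {i}" A u z])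
          show "conformal U (add_mset A (image_mset u (mset_set (I - {i}))))"
            using confS[of "I - {i}" A] by (simp add: S_def)
        qed (use finI z i in \<open>simp_all\<close>)
        have eq: "I - {i} - {j} = I - {i, j}" by auto
        have v: "h (z + sum u (I - {i, j})) \<in> val (S (I - {i, j}))"
          using val0[of "S (I - {i, j})"] j(3) by (simp add: sumS eq)
        have "h (z + A + u j) + h (z + sum u (I - {i, j})) \<le> h (z + A + sum u (I - {i})) + h z"
          using j(4) unfolding eq by simp
        moreover have "j \<in> DA" "i \<noteq> j" "j \<in> I" using j by (auto simp: DA_def)
        ultimately show ?thesis using i(1) v by blast
      qed
      show "\<exists>j\<in>DB. i \<in> I \<and> j \<in> I \<and> i \<noteq> j \<and>
          (\<exists>x\<in>val (S {i, j}). h (z + A + sum u (I - {j})) + x \<le> h (z + A + u i) + \<omega>)"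
        if "i \<in> DA" for i
      proof -
        have i: "i \<in> I" "z + A + u i \<in> D" using that by (auto simp: DA_def)
        have weq: "?w = z + A + u i + B + sum u (I - {i})"
          using i(1) finI by (simp add: sumK sum.remove[of I i] algebra_simps)
        obtain j where j: "j \<in> I - {i}" "z + A + u i + B + u j \<in> D"
          "z + A + u i + sum u (I - {i} - {j}) \<in> D"
          "h (z + A + u i + B + u j) + h (z + A + u i + sum u (I - {i} - {j})) \<le> h (z + A + u i) + h ?w"
        proof (rule jump_M_indexed[OF J, of "I - {i}" B u "z + A + u i"])
          show "conformal U (add_mset B (image_mset u (mset_set (I - {i}))))"
            using confS[of "I - {i}" B] by (simp add: S_def)
          show "z + A + u i + B + sum u (I - {i}) \<in> D" using w weq by simp
        qed (use finI i weq in \<open>simp_all\<close>)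
        have "I - {j} - {i} = I - {i} - {j}" "i \<in> I - {j}" using i j by auto
        then have eq: "u i + sum u (I - {i} - {j}) = sum u (I - {j})"
          using finI sum.remove[of "I - {j}" i u] by simp
        have eq2: "z + A + u i + sum u (I - {i} - {j}) = z + A + sum u (I - {j})"
          unfolding eq[symmetric] by (simp add: add.assoc)
        have v: "h (z + A + u i + B + u j) + c \<in> val (S {i, j})"
          by (rule val1[OF j(2)]) (use j(1) in \<open>simp add: sumS algebra_simps\<close>)
        have "h (z + A + sum u (I - {j})) + (h (z + A + u i + B + u j) + c) \<le> h (z + A + u i) + \<omega>"
          using j(4) unfolding eq2 \<omega>_def by simp
        moreover have "j \<in> DB" "i \<noteq> j" "j \<in> I" using j unfolding eq2 by (auto simp: DB_def)
        ultimately show ?thesis using i(1) v by blast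
      qed
    qed
    \<comment> \<open>the descent excludes every answer to the step \<open>A\<close> except \<open>B\<close>, so \<open>z\<close> and \<open>?w\<close>
      exchange the whole shift, and one of the resulting points is no worse than \<open>z\<close> or \<open>?w\<close>\<close>
    have c1: "conformal U (add_mset A (add_mset B K))" by (rule neither)
    have weq: "?w = z + A + \<Sum>\<^sub># (add_mset B K)" by (simp add: algebra_simps)
    obtain t N where tN: "add_mset B K = add_mset t N" "z + A + t \<in> D" "z + \<Sum>\<^sub># N \<in> D"
      "h (z + A + t) + h (z + \<Sum>\<^sub># N) \<le> h z + h ?w"
      using exc[OF c1 z] w unfolding weq by blast
    have "t \<notin># K"
    proof
      assume "t \<in># K"
      then have "\<exists>i\<in>I. t = u i" using finI by (auto simp: uI)
      then show False using \<open>DA = {}\<close> tN(2) by (auto simp: DA_def)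
    qed
    then have t: "t = B" "N = K" using tN(1) by (auto simp: add_eq_conv_ex)
    have inner: "\<exists>P Q. K = P + Q \<and> size P = 2 \<and> size Q = 2 \<and> v + \<Sum>\<^sub># P \<in> D \<and> v + \<Sum>\<^sub># Q \<in> D \<and>
        h (v + \<Sum>\<^sub># P) + h (v + \<Sum>\<^sub># Q) \<le> h v + h (v + \<Sum>\<^sub># K)"
      if "v \<in> D" "v + \<Sum>\<^sub># K \<in> D" for v
      using jump_M_imp_local_exchange[OF J] conf size that unfolding local_exchange_def by blast
    have "h (z + \<Sum>\<^sub># K) \<le> \<omega> \<or> h (z + (A + B)) + c \<le> h z"
      using tN(4) t \<omega>_def by (auto simp: algebra_simps)
    then show False
    proof
      assume le: "h (z + \<Sum>\<^sub># K) \<le> \<omega>"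
      obtain P Q where *: "K = P + Q" "size P = 2" "size Q = 2" "z + \<Sum>\<^sub># P \<in> D" "z + \<Sum>\<^sub># Q \<in> D"
        "h (z + \<Sum>\<^sub># P) + h (z + \<Sum>\<^sub># Q) \<le> h z + h (z + \<Sum>\<^sub># K)"
        using inner[OF z] tN(3) t by blast
      show False
        by (rule fail[OF *(1-3) val0[OF *(4)] val0[OF *(5)]]) (use *(6) le in simp_all)
    next
      assume le: "h (z + (A + B)) + c \<le> h z"
      have "z + (A + B) \<in> D" using tN(2) t by (simp add: algebra_simps)
      moreover have "z + (A + B) + \<Sum>\<^sub># K = ?w" by (simp add: algebra_simps)
      ultimately obtain P Q where *: "K = P + Q" "size P = 2" "size Q = 2"
        "z + (A + B) + \<Sum>\<^sub># P \<in> D" "z + (A + B) + \<Sum>\<^sub># Q \<in> D"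
        "h (z + (A + B) + \<Sum>\<^sub># P) + h (z + (A + B) + \<Sum>\<^sub># Q) \<le> h (z + (A + B)) + h ?w"
        using inner[of "z + (A + B)"] w by metis
      have v: "h (z + (A + B) + \<Sum>\<^sub># P) + c \<in> val P" "h (z + (A + B) + \<Sum>\<^sub># Q) + c \<in> val Q"
        by (rule val1[OF *(4)], simp add: algebra_simps) (rule val1[OF *(5)], simp add: algebra_simps)
      show False
        by (rule fail[OF *(1-3) v]) (use *(6) le in \<open>simp_all add: \<omega>_def\<close>)
    qed
  qed
qed

text \<open>
  The function \<open>x \<mapsto> min (h x) (h (x - e) + c)\<close>, with \<open>h\<close> read as \<open>\<infinity>\<close> outside \<open>D\<close>: its
  domain and its values there.
\<close>

definition segment_dom :: "'g::ab_group_add set \<Rightarrow> 'g \<Rightarrow> 'g set" where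
  "segment_dom D e = D \<union> {y. y - e \<in> D}"

definition segment_fun :: "'g::ab_group_add set \<Rightarrow> ('g \<Rightarrow> real) \<Rightarrow> 'g \<Rightarrow> real \<Rightarrow> 'g \<Rightarrow> real" where
  "segment_fun D h e c y =
     (if y \<in> D \<and> (y - e \<in> D \<longrightarrow> h y \<le> h (y - e) + c) then h y else h (y - e) + c)"

lemma segment_jump_M:
  fixes U :: "'g::ab_group_add set"
  assumes sym: "\<And>u. u \<in> U \<Longrightarrow> - u \<in> U" and ne: "\<And>u. u \<in> U \<Longrightarrow> u \<noteq> - u"
    and J: "jump_M U D h" and units: "A \<in> U" "B \<in> U" "A \<noteq> - B"
  shows "jump_M U (segment_dom D (A + B)) (segment_fun D h (A + B) c)"
proof (rule local_imp_global[OF sym])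
  define e where "e = A + B"
  define D1 where "D1 = segment_dom D (A + B)"
  define h1 where "h1 = segment_fun D h (A + B) c"
  have units': "- A \<in> U" "- B \<in> U" "- A \<noteq> - (- B)" "- A \<noteq> - (- A)" "- B \<noteq> - (- B)" "A \<noteq> - A" "B \<noteq> - B"
    using units(3) sym[OF units(1)] sym[OF units(2)] ne[OF units(1)] ne[OF units(2)] by auto
  have D1: "v \<in> D1 \<longleftrightarrow> v \<in> D \<or> v - e \<in> D" for v by (auto simp: D1_def segment_dom_def e_def)
  have le0: "h1 v \<le> h v" if "v \<in> D" for v using that by (auto simp: h1_def segment_fun_def)
  have le1: "h1 v \<le> h (v - e) + c" if "v - e \<in> D" for v
    using that by (auto simp: h1_def segment_fun_def e_def)
  have att: "v \<in> D \<and> h1 v = h v \<or> v - e \<in> D \<and> h1 v = h (v - e) + c" if "v \<in> D1" for v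
    using that by (auto simp: D1 h1_def segment_fun_def e_def)
  have stepD: "jump_step U D" by (rule jump_M_imp_jump_step[OF J])
  show "jump_step U (segment_dom D (A + B))"
    unfolding jump_step_def D1_def[symmetric]
  proof (intro allI impI)
    fix x s M assume conf: "conformal U (add_mset s M)" and x: "x \<in> D1" and y: "x + s + \<Sum>\<^sub># M \<in> D1"
    have same: "\<exists>t\<in>#M. v + s + t \<in> D" if "v \<in> D" "v + s + \<Sum>\<^sub># M \<in> D" for v
      using stepD conf that unfolding jump_step_def by blast
    from x y consider "x \<in> D" "x + s + \<Sum>\<^sub># M \<in> D" | "x - e \<in> D" "x + s + \<Sum>\<^sub># M - e \<in> D"
      | "x \<in> D" "x + s + \<Sum>\<^sub># M - e \<in> D" | "x - e \<in> D" "x + s + \<Sum>\<^sub># M \<in> D"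
      unfolding D1 by blast
    then show "\<exists>t\<in>#M. x + s + t \<in> D1"
    proof cases
      case 1
      then show ?thesis using same D1 by blast
    next
      case 2
      have eq: "x - e + s + \<Sum>\<^sub># M = x + s + \<Sum>\<^sub># M - e" by (simp add: algebra_simps)
      obtain t where t: "t \<in># M" "x - e + s + t \<in> D" using same[OF 2(1)] 2(2) unfolding eq by blast
      have "x - e + s + t = x + s + t - e" by (simp add: algebra_simps)
      then show ?thesis using t D1 by metis
    next
      case 3
      have eq: "x + s + \<Sum>\<^sub># M + (- A + - B) = x + s + \<Sum>\<^sub># M - e" by (simp add: e_def algebra_simps)
      obtain t where t: "t \<in># M" "x + s + t \<in> D \<or> x + s + t + (- A + - B) \<in> D"
        using segment_step_core[OF stepD units'(1-5) conf 3(1)] 3(2) unfolding eq by blast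
      have "x + s + t + (- A + - B) = x + s + t - e" by (simp add: e_def algebra_simps)
      then show ?thesis using t D1 by metis
    next
      case 4
      have eq: "x - e + s + \<Sum>\<^sub># M + (A + B) = x + s + \<Sum>\<^sub># M" by (simp add: e_def algebra_simps)
      obtain t where t: "t \<in># M" "x - e + s + t \<in> D \<or> x - e + s + t + (A + B) \<in> D"
        using segment_step_core[OF stepD units units'(6,7) conf 4(1)] 4(2) unfolding eq by blast
      have "x - e + s + t = x + s + t - e" "x - e + s + t + (A + B) = x + s + t"
        by (simp_all add: e_def algebra_simps)
      then show ?thesis using t D1 by metis
    qed
  qed
  show "local_exchange U (segment_dom D (A + B)) (segment_fun D h (A + B) c)"
    unfolding local_exchange_def D1_def[symmetric] h1_def[symmetric]
  proof (intro allI impI)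
    fix x K assume conf: "conformal U K" and size: "size K = 4"
      and x: "x \<in> D1" and y: "x + \<Sum>\<^sub># K \<in> D1"
    let ?y = "x + \<Sum>\<^sub># K"
    let ?concl = "\<exists>P Q. K = P + Q \<and> size P = 2 \<and> size Q = 2 \<and> x + \<Sum>\<^sub># P \<in> D1 \<and> x + \<Sum>\<^sub># Q \<in> D1 \<and>
        h1 (x + \<Sum>\<^sub># P) + h1 (x + \<Sum>\<^sub># Q) \<le> h1 x + h1 ?y"
    have same: "\<exists>P Q. K = P + Q \<and> size P = 2 \<and> size Q = 2 \<and> v + \<Sum>\<^sub># P \<in> D \<and> v + \<Sum>\<^sub># Q \<in> D \<and>
        h (v + \<Sum>\<^sub># P) + h (v + \<Sum>\<^sub># Q) \<le> h v + h (v + \<Sum>\<^sub># K)"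
      if "v \<in> D" "v + \<Sum>\<^sub># K \<in> D" for v
      using jump_M_imp_local_exchange[OF J] conf size that unfolding local_exchange_def by blast
    \<comment> \<open>the shifts at which \<open>h1 x\<close> and \<open>h1 ?y\<close> are attained either agree or differ by \<open>e\<close>\<close>
    from att[OF x] att[OF y] consider "x \<in> D" "h1 x = h x" "?y \<in> D" "h1 ?y = h ?y"
      | "x - e \<in> D" "h1 x = h (x - e) + c" "?y - e \<in> D" "h1 ?y = h (?y - e) + c"
      | "x \<in> D" "h1 x = h x" "?y - e \<in> D" "h1 ?y = h (?y - e) + c"
      | "x - e \<in> D" "h1 x = h (x - e) + c" "?y \<in> D" "h1 ?y = h ?y"
      by blast
    then show ?concl
    proof cases
      case 1
      then obtain P Q where "K = P + Q" "size P = 2" "size Q = 2" "x + \<Sum>\<^sub># P \<in> D" "x + \<Sum>\<^sub># Q \<in> D"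
        "h (x + \<Sum>\<^sub># P) + h (x + \<Sum>\<^sub># Q) \<le> h x + h (x + \<Sum>\<^sub># K)" using same[of x] by blast
      then show ?thesis using 1 D1 le0[of "x + \<Sum>\<^sub># P"] le0[of "x + \<Sum>\<^sub># Q"]
        by (intro exI[of _ P] exI[of _ Q]) auto
    next
      case 2
      have sh: "x - e + v = x + v - e" for v by (simp add: algebra_simps)
      obtain P Q where "K = P + Q" "size P = 2" "size Q = 2" "x + \<Sum>\<^sub># P - e \<in> D" "x + \<Sum>\<^sub># Q - e \<in> D"
        "h (x + \<Sum>\<^sub># P - e) + h (x + \<Sum>\<^sub># Q - e) \<le> h (x - e) + h (x + \<Sum>\<^sub># K - e)"
        using same[of "x - e"] 2 unfolding sh by blast
      then show ?thesis using 2 D1 le1[of "x + \<Sum>\<^sub># P"] le1[of "x + \<Sum>\<^sub># Q"]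
        by (intro exI[of _ P] exI[of _ Q]) auto
    next
      case 3
      have sh: "v + (- A + - B) = v - e" for v by (simp add: e_def algebra_simps)
      obtain P Q p q where PQ: "K = P + Q" "size P = 2" "size Q = 2"
        and p: "p \<in> h ` (D \<inter> {x + \<Sum>\<^sub># P}) \<union> (\<lambda>v. h v + c) ` (D \<inter> {x + \<Sum>\<^sub># P - e})"
        and q: "q \<in> h ` (D \<inter> {x + \<Sum>\<^sub># Q}) \<union> (\<lambda>v. h v + c) ` (D \<inter> {x + \<Sum>\<^sub># Q - e})"
        and pq: "p + q \<le> h x + h (?y - e) + c"
        using segment_local_core[OF J units'(1-5) conf size 3(1), of c] 3(3) unfolding sh by blast
      have "x + \<Sum>\<^sub># P \<in> D1 \<and> h1 (x + \<Sum>\<^sub># P) \<le> p" "x + \<Sum>\<^sub># Q \<in> D1 \<and> h1 (x + \<Sum>\<^sub># Q) \<le> q"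
        using p q le0 le1 by (auto simp: D1)
      then show ?thesis using PQ pq 3 by (intro exI[of _ P] exI[of _ Q]) auto
    next
      case 4
      have sh: "x - e + v = x + v - e" "x + v - e + (A + B) = x + v" for v
        by (simp_all add: e_def algebra_simps)
      obtain P Q p q where PQ: "K = P + Q" "size P = 2" "size Q = 2"
        and p: "p \<in> h ` (D \<inter> {x + \<Sum>\<^sub># P - e}) \<union> (\<lambda>v. h v + - c) ` (D \<inter> {x + \<Sum>\<^sub># P})"
        and q: "q \<in> h ` (D \<inter> {x + \<Sum>\<^sub># Q - e}) \<union> (\<lambda>v. h v + - c) ` (D \<inter> {x + \<Sum>\<^sub># Q})"
        and pq: "p + q \<le> h (x - e) + h ?y + - c"
        using segment_local_core[OF J units units'(6,7) conf size 4(1), of "- c"] 4(3) unfolding sh by blast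
      have "x + \<Sum>\<^sub># P \<in> D1 \<and> h1 (x + \<Sum>\<^sub># P) \<le> p + c" "x + \<Sum>\<^sub># Q \<in> D1 \<and> h1 (x + \<Sum>\<^sub># Q) \<le> q + c"
        using p q le0 le1 by (auto simp: D1)
      then show ?thesis using PQ pq 4 by (intro exI[of _ P] exI[of _ Q]) auto
    qed
  qed
qed

section \<open>Convolution with a convex function on a line\<close>

text \<open>
  \<open>h\<close> on \<open>D\<close> is the attained minimum of the costs that the relation \<open>R\<close> offers at each point;
  \<open>R\<close> may offer several costs at one point.
\<close>

definition lower_envelope :: "('g \<times> real) set \<Rightarrow> 'g set \<Rightarrow> ('g \<Rightarrow> real) \<Rightarrow> bool" where
  "lower_envelope R D h \<longleftrightarrow>
     (\<forall>(y, c)\<in>R. y \<in> D \<and> h y \<le> c) \<and> (\<forall>y\<in>D. \<exists>c. (y, c) \<in> R \<and> c \<le> h y)"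

lemma lower_envelope_above:
  "lower_envelope R D h \<Longrightarrow> (y, c) \<in> R \<Longrightarrow> y \<in> D \<and> h y \<le> c"
  unfolding lower_envelope_def by blast

lemma lower_envelope_attained:
  "lower_envelope R D h \<Longrightarrow> y \<in> D \<Longrightarrow> \<exists>c. (y, c) \<in> R \<and> c \<le> h y"
  unfolding lower_envelope_def by blast

lemma jump_M_translate:
  fixes d :: "'g::ab_group_add"
  assumes "jump_M U D h"
  shows "jump_M U {y. y - d \<in> D} (\<lambda>y. h (y - d) + c)"
proof -
  have sh: "x + v - d = x - d + v" for x v by (simp add: algebra_simps)
  show ?thesis
    unfolding jump_M_def mem_Collect_eq
  proof (intro allI impI)
    fix x s M
    assume *: "conformal U (add_mset s M)" "x - d \<in> D" "x + s + \<Sum>\<^sub># M - d \<in> D"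
    then have "x - d + s + \<Sum>\<^sub># M \<in> D" by (simp add: sh)
    with * assms obtain t N where "M = add_mset t N" "x - d + s + t \<in> D" "x - d + \<Sum>\<^sub># N \<in> D"
      "h (x - d + s + t) + h (x - d + \<Sum>\<^sub># N) \<le> h (x - d) + h (x - d + s + \<Sum>\<^sub># M)"
      unfolding jump_M_def by blast
    then show "\<exists>t N. M = add_mset t N \<and> x + s + t - d \<in> D \<and> x + \<Sum>\<^sub># N - d \<in> D \<and>
        h (x + s + t - d) + c + (h (x + \<Sum>\<^sub># N - d) + c) \<le> h (x - d) + c + (h (x + s + \<Sum>\<^sub># M - d) + c)"
      by (intro exI[of _ t] exI[of _ N]) (simp add: sh)
  qed
qed

text \<open>
  \<open>E k\<close> is the displacement caused by the value \<open>k\<close>; consecutive values differ by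
  \<open>A + B\<close>. Extending the interval by one value is a convolution with a segment whose constant is
  the last slope of \<open>\<phi>\<close>. That convolution also allows the last step to be added to a value
  \<open>k\<close> below the end of the interval, at a cost that convexity makes at least the cost of
  \<open>k + 1\<close>. For \<open>A = - B\<close>, a loop, the displacement is constant.
\<close>

lemma arc_jump_M:
  fixes U :: "'g::ab_group_add set" and E :: "int \<Rightarrow> 'g" and \<phi> :: "int \<Rightarrow> real"
  assumes sym: "\<And>u. u \<in> U \<Longrightarrow> - u \<in> U" and ne: "\<And>u. u \<in> U \<Longrightarrow> u \<noteq> - u"
    and J: "jump_M U D h" and units: "A \<in> U" "B \<in> U"
    and E: "\<And>k. E (k + 1) = E k + (A + B)"
    and convex: "\<And>j k. l \<le> j \<Longrightarrow> j \<le> k \<Longrightarrow> k < l + int n \<Longrightarrow> \<phi> (j + 1) - \<phi> j \<le> \<phi> (k + 1) - \<phi> k"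
  shows "\<exists>D' h'. jump_M U D' h' \<and>
    lower_envelope {(y + E k, h y + \<phi> k) | y k. y \<in> D \<and> l \<le> k \<and> k \<le> l + int n} D' h'"
proof (cases "A = - B")
  case True
  have Ek: "E k = E 0" for k
  proof (induction k rule: int_induct[where k = 0])
    case (step2 i)
    then show ?case using E[of "i - 1"] True by simp
  qed (use E True in simp_all)
  obtain m where m: "m \<in> {l..l + int n}" "\<And>k. k \<in> {l..l + int n} \<Longrightarrow> \<phi> m \<le> \<phi> k"
    using ex_is_arg_min_if_finite[of "{l..l + int n}" \<phi>] by (auto simp: is_arg_min_linorder)
  have "lower_envelope {(y + E k, h y + \<phi> k) | y k. y \<in> D \<and> l \<le> k \<and> k \<le> l + int n}
      {y. y - E 0 \<in> D} (\<lambda>y. h (y - E 0) + \<phi> m)"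
    unfolding lower_envelope_def
  proof (intro conjI ballI)
    fix yc assume "yc \<in> {(y + E k, h y + \<phi> k) | y k. y \<in> D \<and> l \<le> k \<and> k \<le> l + int n}"
    then obtain y k where "yc = (y + E k, h y + \<phi> k)" "y \<in> D" "k \<in> {l..l + int n}" by auto
    then show "case yc of (y, c) \<Rightarrow> y \<in> {y. y - E 0 \<in> D} \<and> h (y - E 0) + \<phi> m \<le> c"
      using m(2)[of k] by (simp add: Ek[of k])
  next
    fix y assume "y \<in> {y. y - E 0 \<in> D}"
    then show "\<exists>c. (y, c) \<in> {(y + E k, h y + \<phi> k) | y k. y \<in> D \<and> l \<le> k \<and> k \<le> l + int n} \<and>
        c \<le> h (y - E 0) + \<phi> m"
      using m(1) Ek[of m] by (intro exI[of _ "h (y - E 0) + \<phi> m"]) (auto intro!: exI[of _ "y - E 0"] exI[of _ m])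
  qed
  then show ?thesis using jump_M_translate[OF J] by blast
next
  case False
  show ?thesis
    using convex
  proof (induction n)
    case 0
    have "lower_envelope {(y + E k, h y + \<phi> k) | y k. y \<in> D \<and> l \<le> k \<and> k \<le> l + int 0}
        {y. y - E l \<in> D} (\<lambda>y. h (y - E l) + \<phi> l)"
      by (auto simp: lower_envelope_def)
        (metis diff_add_cancel order_refl)
    then show ?case using jump_M_translate[OF J] by blast
  next
    case (Suc n)
    let ?R = "\<lambda>n. {(y + E k, h y + \<phi> k) | y k. y \<in> D \<and> l \<le> k \<and> k \<le> l + int n}"
    let ?e = "A + B"
    have "\<And>j k. l \<le> j \<Longrightarrow> j \<le> k \<Longrightarrow> k < l + int n \<Longrightarrow> \<phi> (j + 1) - \<phi> j \<le> \<phi> (k + 1) - \<phi> k"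
      using Suc.prems by simp
    from Suc.IH[OF this] obtain D' h' where J': "jump_M U D' h'" and env: "lower_envelope (?R n) D' h'"
      by blast
    define c where "c = \<phi> (l + int n + 1) - \<phi> (l + int n)"
    have R: "y + E k \<in> D' \<and> h' (y + E k) \<le> h y + \<phi> k" if "y \<in> D" "l \<le> k" "k \<le> l + int n" for y k
      using env that unfolding lower_envelope_def by fast
    have R': "\<exists>y k. v = y + E k \<and> y \<in> D \<and> l \<le> k \<and> k \<le> l + int n \<and> h y + \<phi> k \<le> h' v" if "v \<in> D'" for v
      using env that unfolding lower_envelope_def by blast
    have "lower_envelope (?R (Suc n)) (segment_dom D' ?e) (segment_fun D' h' ?e c)"
      unfolding lower_envelope_def
    proof (intro conjI ballI)
      fix yc assume "yc \<in> ?R (Suc n)"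
      then obtain y k where yc: "yc = (y + E k, h y + \<phi> k)" "y \<in> D" "l \<le> k" "k \<le> l + int (Suc n)" by blast
      have "y + E k \<in> segment_dom D' ?e \<and> segment_fun D' h' ?e c (y + E k) \<le> h y + \<phi> k"
      proof (cases "k \<le> l + int n")
        case True
        then show ?thesis using R[OF yc(2,3)] by (auto simp: segment_dom_def segment_fun_def)
      next
        case False
        then have k: "k = (l + int n) + 1" using yc by simp
        have eq: "y + E k - ?e = y + E (l + int n)" unfolding k E by (simp add: algebra_simps)
        have "y + E k - ?e \<in> D'" "h' (y + E k - ?e) + c \<le> h y + \<phi> k"
          unfolding eq unfolding c_def k using R[of y "l + int n"] yc(2) by auto
        then show ?thesis by (auto simp: segment_dom_def segment_fun_def)
      qed
      then show "case yc of (y, ca) \<Rightarrow> y \<in> segment_dom D' ?e \<and> segment_fun D' h' ?e c y \<le> ca"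
        using yc by simp
    next
      fix v assume v: "v \<in> segment_dom D' ?e"
      then have "v \<in> D' \<and> segment_fun D' h' ?e c v = h' v \<or>
          v - ?e \<in> D' \<and> segment_fun D' h' ?e c v = h' (v - ?e) + c"
        by (auto simp: segment_dom_def segment_fun_def)
      then consider "v \<in> D'" "segment_fun D' h' ?e c v = h' v"
        | "v - ?e \<in> D'" "segment_fun D' h' ?e c v = h' (v - ?e) + c"
        by blast
      then show "\<exists>ca. (v, ca) \<in> ?R (Suc n) \<and> ca \<le> segment_fun D' h' ?e c v"
      proof cases
        case 1
        obtain y k where "v = y + E k" "y \<in> D" "l \<le> k" "k \<le> l + int n" "h y + \<phi> k \<le> h' v"
          using R'[OF 1(1)] by blast
        then show ?thesis using 1(2) by (intro exI[of _ "h y + \<phi> k"]) (auto intro!: exI[of _ y] exI[of _ k])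
      next
        case 2
        obtain y k where yk: "v - ?e = y + E k" "y \<in> D" "l \<le> k" "k \<le> l + int n"
          "h y + \<phi> k \<le> h' (v - ?e)"
          using R'[OF 2(1)] by blast
        have "v = y + E (k + 1)" using yk(1) unfolding E by (simp add: algebra_simps)
        moreover have "\<phi> (k + 1) - \<phi> k \<le> c" unfolding c_def by (rule Suc.prems) (use yk in auto)
        ultimately show ?thesis using 2(2) yk
          by (intro exI[of _ "h y + \<phi> (k + 1)"]) (auto intro!: exI[of _ y] exI[of _ "k + 1"])
      qed
    qed
    then show ?case using segment_jump_M[OF sym ne J' units False] by blast
  qed
qed

section \<open>The parity coordinate\<close>

text \<open>The exchange axiom with single and double steps, in terms of conformal multisets.\<close>

definition jump_Mnat :: "'g::ab_group_add set \<Rightarrow> 'g set \<Rightarrow> ('g \<Rightarrow> real) \<Rightarrow> bool" where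
  "jump_Mnat U D h \<longleftrightarrow>
     (\<forall>x s M. conformal U (add_mset s M) \<longrightarrow> x \<in> D \<longrightarrow> x + s + \<Sum>\<^sub># M \<in> D \<longrightarrow>
        (x + s \<in> D \<and> x + \<Sum>\<^sub># M \<in> D \<and> h (x + s) + h (x + \<Sum>\<^sub># M) \<le> h x + h (x + s + \<Sum>\<^sub># M)) \<or>
        (\<exists>t N. M = add_mset t N \<and> x + s + t \<in> D \<and> x + \<Sum>\<^sub># N \<in> D \<and>
               h (x + s + t) + h (x + \<Sum>\<^sub># N) \<le> h x + h (x + s + \<Sum>\<^sub># M)))"

lemma jump_MnatD:
  assumes "jump_Mnat U D h" "conformal U (add_mset s M)" "x \<in> D" "x + s + \<Sum>\<^sub># M \<in> D"
  obtains (single) "x + s \<in> D" "x + \<Sum>\<^sub># M \<in> D" "h (x + s) + h (x + \<Sum>\<^sub># M) \<le> h x + h (x + s + \<Sum>\<^sub># M)"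
    | (double) t N where "M = add_mset t N" "x + s + t \<in> D" "x + \<Sum>\<^sub># N \<in> D"
      "h (x + s + t) + h (x + \<Sum>\<^sub># N) \<le> h x + h (x + s + \<Sum>\<^sub># M)"
  using assms unfolding jump_Mnat_def by blast

text \<open>
  At odd distance a single step inside the domain exists: exchanges with double steps lower the
  distance by two until a single step remains.
\<close>

lemma jump_Mnat_odd_step:
  assumes J: "jump_Mnat U D h" and x: "x \<in> D"
  shows "conformal U M \<Longrightarrow> odd (size M) \<Longrightarrow> x + \<Sum>\<^sub># M \<in> D \<Longrightarrow> \<exists>t\<in>#M. x + t \<in> D"
proof (induction "size M" arbitrary: M rule: less_induct)
  case less
  then have "M \<noteq> {#}" by auto
  then obtain s M1 where M: "M = add_mset s M1" by (meson multiset_cases)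
  have c: "conformal U (add_mset s M1)" using less.prems M by simp
  have y: "x + s + \<Sum>\<^sub># M1 \<in> D" using less.prems M by (simp add: add.assoc)
  show ?case
  proof (rule jump_MnatD[OF J c x y])
    assume "x + s \<in> D"
    then show ?thesis using M by auto
  next
    fix t N assume N: "M1 = add_mset t N" "x + \<Sum>\<^sub># N \<in> D"
    have "\<exists>t\<in>#N. x + t \<in> D"
      using less.hyps[of N] less.prems N M conformal_subset[OF c, of N] by force
    then show ?thesis using M N by auto
  qed
qed

text \<open>At distance 3 one of the three steps can be exchanged alone, since a double step from one end
  is a single step seen from the other.\<close>

lemma jump_Mnat_three_steps:
  fixes u :: "nat \<Rightarrow> 'g::ab_group_add"
  assumes J: "jump_Mnat U D h" and card: "card I = 3"
    and conf: "conformal U (image_mset u (mset_set I))" and x: "x \<in> D" "x + sum u I \<in> D"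
  obtains k where "k \<in> I" "x + u k \<in> D" "x + sum u (I - {k}) \<in> D"
    "h (x + u k) + h (x + sum u (I - {k})) \<le> h x + h (x + sum u I)"
proof -
  have fin: "finite I" using card by (auto intro: card_ge_0_finite)
  obtain l where l: "l \<in> I" using card by fastforce
  define M where "M = image_mset u (mset_set (I - {l}))"
  have split: "image_mset u (mset_set I) = add_mset (u l) M"
    using l fin by (simp add: M_def mset_set.remove[of I l])
  have sumM: "\<Sum>\<^sub># M = sum u (I - {l})" by (simp add: M_def sum_unfold_sum_mset)
  have eq: "x + u l + \<Sum>\<^sub># M = x + sum u I" using l fin by (simp add: sumM sum.remove[of I l] add.assoc)
  show ?thesis
  proof (rule jump_MnatD[OF J conf[unfolded split] x(1)])
    show "x + u l + \<Sum>\<^sub># M \<in> D" unfolding eq by (rule x(2))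
  next
    assume "x + u l \<in> D" "x + \<Sum>\<^sub># M \<in> D" "h (x + u l) + h (x + \<Sum>\<^sub># M) \<le> h x + h (x + u l + \<Sum>\<^sub># M)"
    then show ?thesis using that[OF l] unfolding eq unfolding sumM by blast
  next
    fix t N
    assume N: "M = add_mset t N" and *: "x + u l + t \<in> D" "x + \<Sum>\<^sub># N \<in> D"
      "h (x + u l + t) + h (x + \<Sum>\<^sub># N) \<le> h x + h (x + u l + \<Sum>\<^sub># M)"
    have "t \<in># M" using N by simp
    then obtain m where m: "m \<in> I - {l}" "t = u m" using fin by (auto simp: M_def)
    have "card (I - {l, m}) = 1" using card l m fin by (simp add: card_Diff_subset)
    then obtain k where k: "I - {l, m} = {k}" by (auto simp: card_1_singleton_iff)
    have "\<Sum>\<^sub># M = t + \<Sum>\<^sub># N" using N by simp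
    moreover have "sum u (I - {l}) = u m + sum u (I - {l} - {m})" using m fin by (simp add: sum.remove)
    moreover have "I - {l} - {m} = {k}" using k by auto
    ultimately have Nk: "\<Sum>\<^sub># N = u k" using sumM m by simp
    have "I - {k} = {l, m}" "l \<noteq> m" "k \<in> I" using k l m by auto
    then have s: "sum u (I - {k}) = u l + u m" by simp
    show ?thesis
      by (rule that[of k]) (use \<open>k \<in> I\<close> * s m Nk eq in \<open>simp_all add: add.assoc\<close>)
  qed
qed

text \<open>
  The additional coordinate takes the values 0 and 1, and makes the sum of \<open>par x\<close> and itself
  even, so it is determined by \<open>x\<close>.
\<close>

definition lift_units :: "'g::ab_group_add set \<Rightarrow> ('g \<times> int) set" where
  "lift_units U = (\<lambda>u. (u, 0)) ` U \<union> {(0, 1), (0, -1)}"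

definition lift_dom :: "('g \<Rightarrow> int) \<Rightarrow> 'g set \<Rightarrow> ('g \<times> int) set" where
  "lift_dom par D = {(x, k). x \<in> D \<and> (k = 0 \<or> k = 1) \<and> even (par x + k)}"

lemma sum_mset_lift: "\<Sum>\<^sub># (image_mset (\<lambda>u. (u, 0)) M) = (\<Sum>\<^sub># M, 0 :: int)"
  by (induction M) (auto simp: zero_prod_def)

lemma snd_sum_mset: "snd (\<Sum>\<^sub># M) = \<Sum>\<^sub># (image_mset snd M)"
  by (induction M) auto

lemma conformal_lift_cases:
  assumes conf: "conformal (lift_units U) M" and le: "\<bar>snd (\<Sum>\<^sub># M)\<bar> \<le> 1"
  obtains (same) M1 where "conformal U M1" "M = image_mset (\<lambda>u. (u, 0)) M1"
    | (flip) M1 c where "conformal U M1" "M = add_mset (0, c) (image_mset (\<lambda>u. (u, 0)) M1)" "c = 1 \<or> c = -1"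
proof -
  define M0 where "M0 = filter_mset (\<lambda>m. snd m = 0) M"
  define M2 where "M2 = filter_mset (\<lambda>m. \<not> snd m = 0) M"
  define M1 where "M1 = image_mset fst M0"
  have M: "M = M0 + M2" unfolding M0_def M2_def by (rule multiset_partition)
  have M0: "image_mset (\<lambda>u. (u, 0)) M1 = M0"
    unfolding M1_def multiset.map_comp
    by (rule multiset.map_ident_strong) (auto simp: M0_def)
  have mem1: "(u, 0) \<in># M" if "u \<in># M1" for u
  proof -
    have "(u, 0) \<in># image_mset (\<lambda>u. (u, 0 :: int)) M1" using that by auto
    then show ?thesis unfolding M0 M by auto
  qed
  have c1: "conformal U M1"
    unfolding conformal_def
  proof (intro conjI subsetI ballI notI)
    fix u assume u: "u \<in># M1"
    then show "u \<in> U" using mem1[OF u] conf by (auto simp: conformal_def lift_units_def)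
    assume "- u \<in># M1"
    then have "- (u, 0) \<in># M" using mem1[of "- u"] by simp
    then show False using mem1[OF u] conf unfolding conformal_def by blast
  qed
  have mem2: "m = (0, 1) \<or> m = (0, -1)" if "m \<in># M2" for m
    using that conf by (auto simp: M2_def conformal_def lift_units_def)
  show ?thesis
  proof (cases "M2 = {#}")
    case True
    then show ?thesis using same[OF c1] M M0 by simp
  next
    case False
    then obtain m where m: "m \<in># M2" by (meson multiset_nonemptyE)
    have "m' = m" if "m' \<in># M2" for m'
    proof (rule ccontr)
      assume "m' \<noteq> m"
      then have "m' = - m" using mem2[OF m] mem2[OF that] by auto
      then show False using m that conf M unfolding conformal_def by auto
    qed
    then have "set_mset M2 \<subseteq> {m}" by auto
    then have "M2 = replicate_mset (size M2) m" by (rule set_mset_subset_singletonD)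
    then obtain n where n: "M2 = replicate_mset n m" by blast
    have "snd (\<Sum>\<^sub># M) = snd (\<Sum>\<^sub># M0) + snd (\<Sum>\<^sub># M2)" using M by simp
    moreover have "snd (\<Sum>\<^sub># M0) = 0" unfolding M0[symmetric] sum_mset_lift by simp
    moreover have "snd (\<Sum>\<^sub># M2) = int n * snd m"
      unfolding n snd_sum_mset by (induction n) (auto simp: algebra_simps)
    ultimately have "\<bar>int n * snd m\<bar> \<le> 1" using le by simp
    then have "n \<le> 1" using mem2[OF m] by auto
    moreover have "n \<noteq> 0" using n m by (auto split: if_splits)
    ultimately have "M2 = {#m#}" using n by (cases n) auto
    then have "M = add_mset m (image_mset (\<lambda>u. (u, 0)) M1)" using M M0 by simp
    then show ?thesis using mem2[OF m] flip[OF c1, of 1] flip[OF c1, of "-1"] by auto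
  qed
qed

text \<open>
  At distance 4 the parity coordinate is either among the four steps, which reduces the claim to
  one exchange of the original function, or it is not, and the descent applies with the points
  at which one step has been made or is missing.
\<close>

lemma lift_jump_M:
  fixes U :: "'g::ab_group_add set" and par :: "'g \<Rightarrow> int"
  assumes sym: "\<And>u. u \<in> U \<Longrightarrow> - u \<in> U"
    and J: "jump_Mnat U D h"
    and par: "\<And>x y. par (x + y) = par x + par y" "\<And>u. u \<in> U \<Longrightarrow> odd (par u)"
  shows "jump_M (lift_units U) (lift_dom par D) (h \<circ> fst)"
proof (rule local_imp_global)
  show "- u \<in> lift_units U" if "u \<in> lift_units U" for u
    using that sym by (auto simp: lift_units_def)
  let ?\<iota> = "\<lambda>u::'g. (u, 0::int)"
  have parsum: "even (par (\<Sum>\<^sub># M)) \<longleftrightarrow> even (size M)" if "set_mset M \<subseteq> U" for M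
    using that
  proof (induction M)
    case empty
    show ?case using par(1)[of 0 0] by simp
  next
    case (add u M)
    then show ?case using par(2)[of u] by (simp add: par(1))
  qed
  have dom: "(x, k) \<in> lift_dom par D \<longleftrightarrow> x \<in> D \<and> (k = 0 \<or> k = 1) \<and> even (par x + k)" for x k
    by (simp add: lift_dom_def)
  have bound: "\<bar>snd v\<bar> \<le> 1" if "X \<in> lift_dom par D" "X + v \<in> lift_dom par D" for X v
    using that by (cases X; cases v) (auto simp: lift_dom_def)
  show "jump_step (lift_units U) (lift_dom par D)"
    unfolding jump_step_def
  proof (intro allI impI)
    fix X S M
    assume conf: "conformal (lift_units U) (add_mset S M)" and X: "X \<in> lift_dom par D"
      and Y: "X + S + \<Sum>\<^sub># M \<in> lift_dom par D"
    obtain x k where Xx: "X = (x, k)" by (cases X)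
    have x: "x \<in> D" and k: "k = 0 \<or> k = 1" "even (par x + k)" using X dom Xx by auto
    have Y': "X + \<Sum>\<^sub># (add_mset S M) \<in> lift_dom par D" using Y by (simp add: add.assoc)
    from conf bound[OF X Y'] show "\<exists>t\<in>#M. X + S + t \<in> lift_dom par D"
    proof (cases rule: conformal_lift_cases)
      case (same K1)
      then obtain s M1 where K1': "K1 = add_mset s M1" "?\<iota> s = S" "image_mset ?\<iota> M1 = M"
        using msed_map_invR[OF same(2)[symmetric]] by blast
      note K1 = K1'(1) K1'(2,3)[symmetric]
      have c: "conformal U (add_mset s M1)" using same K1 by simp
      then have sub: "s \<in> U" "set_mset M1 \<subseteq> U" by (auto simp: conformal_def)
      have y: "x + s + \<Sum>\<^sub># M1 \<in> D" and y2: "even (par (x + s + \<Sum>\<^sub># M1) + k)"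
        using Y unfolding Xx K1 sum_mset_lift by (simp_all add: dom)
      have oddM: "odd (size M1)"
        using y2 k(2) par(2)[OF sub(1)] parsum[OF sub(2)] by (cases "even k") (simp_all add: par(1))
      have "\<exists>t\<in>#M1. x + s + t \<in> D"
      proof (rule jump_MnatD[OF J c x y])
        assume "x + s \<in> D"
        then show ?thesis
          using jump_Mnat_odd_step[OF J _ conformal_subset[OF c] oddM y] by auto
      qed auto
      then obtain t where t: "t \<in># M1" "x + s + t \<in> D" by blast
      have "t \<in> U" using t sub by blast
      then have "(x + s + t, k) \<in> lift_dom par D"
        using t k par(2)[OF sub(1)] par(2)[of t] by (simp add: dom par(1))
      then show ?thesis using t unfolding Xx K1 by (intro bexI[of _ "?\<iota> t"]) auto
    next
      case (flip K1 c)
      have y: "x + \<Sum>\<^sub># K1 \<in> D" and y2: "k + c = 0 \<or> k + c = 1" "even (par (x + \<Sum>\<^sub># K1) + (k + c))"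
        using Y' unfolding Xx flip sum_mset.add_mset sum_mset_lift by (simp_all add: dom)
      from flip(2) consider "S = (0, c)" "M = image_mset ?\<iota> K1"
        | M' where "M = add_mset (0, c) M'" "image_mset ?\<iota> K1 = add_mset S M'"
        unfolding add_eq_conv_ex by blast
      then show ?thesis
      proof cases
        case 1
        have sub: "set_mset K1 \<subseteq> U" using flip(1) by (simp add: conformal_def)
        have "odd (size K1)" using y2 k(2) parsum[OF sub] flip(3) by (auto simp: par(1))
        then obtain t where t: "t \<in># K1" "x + t \<in> D"
          using jump_Mnat_odd_step[OF J x flip(1) _ y] by blast
        have "t \<in> U" using t sub by blast
        then have "(x + t, k + c) \<in> lift_dom par D"
          using t k y2 flip(3) par(2)[of t] by (auto simp: dom par(1))
        then show ?thesis using t unfolding Xx 1 by (intro bexI[of _ "?\<iota> t"]) auto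
      next
        case 2
        then obtain s M1 where K1': "K1 = add_mset s M1" "?\<iota> s = S" "image_mset ?\<iota> M1 = M'"
          using msed_map_invR[OF 2(2)] by blast
        note K1 = K1'(1) K1'(2,3)[symmetric]
        have c: "conformal U (add_mset s M1)" using flip K1 by simp
        then have sub: "s \<in> U" "set_mset M1 \<subseteq> U" by (auto simp: conformal_def)
        have y': "x + s + \<Sum>\<^sub># M1 \<in> D" using y K1 by (simp add: add.assoc)
        show ?thesis
        proof (rule jump_MnatD[OF J c x y'])
          assume "x + s \<in> D"
          then have "(x + s, k + c) \<in> lift_dom par D"
            using k y2(1) flip(3) par(2)[OF sub(1)] by (auto simp: dom par(1))
          then show ?thesis unfolding Xx 2 K1 by (intro bexI[of _ "(0, c)"]) auto
        next
          fix t N assume t: "M1 = add_mset t N" "x + s + t \<in> D"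
          have "t \<in> U" using t sub by auto
          then have "(x + s + t, k) \<in> lift_dom par D"
            using t k par(2)[OF sub(1)] par(2)[of t] by (simp add: dom par(1))
          then show ?thesis using t unfolding Xx 2 K1 by (intro bexI[of _ "?\<iota> t"]) auto
        qed
      qed
    qed
  qed
  show "local_exchange (lift_units U) (lift_dom par D) (h \<circ> fst)"
    unfolding local_exchange_def
  proof (intro allI impI)
    fix X K
    assume conf: "conformal (lift_units U) K" and size: "size K = 4" and X: "X \<in> lift_dom par D"
      and Y: "X + \<Sum>\<^sub># K \<in> lift_dom par D"
    obtain x k where Xx: "X = (x, k)" by (cases X)
    have x: "x \<in> D" and k: "k = 0 \<or> k = 1" "even (par x + k)" using X dom Xx by auto
    let ?concl = "\<exists>P Q. K = P + Q \<and> size P = 2 \<and> size Q = 2 \<and> X + \<Sum>\<^sub># P \<in> lift_dom par D \<and>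
        X + \<Sum>\<^sub># Q \<in> lift_dom par D \<and>
        (h \<circ> fst) (X + \<Sum>\<^sub># P) + (h \<circ> fst) (X + \<Sum>\<^sub># Q) \<le> (h \<circ> fst) X + (h \<circ> fst) (X + \<Sum>\<^sub># K)"
    have concl: ?concl
      if "K = P + Q" "size P = 2" "size Q = 2" "X + \<Sum>\<^sub># P = (p, i)" "X + \<Sum>\<^sub># Q = (q, j)"
        "(p, i) \<in> lift_dom par D" "(q, j) \<in> lift_dom par D" "X + \<Sum>\<^sub># K = (r, l)" "h p + h q \<le> h x + h r"
      for P Q p q r i j l
    proof (rule exI[of _ P], rule exI[of _ Q], intro conjI)
      show "(h \<circ> fst) (X + \<Sum>\<^sub># P) + (h \<circ> fst) (X + \<Sum>\<^sub># Q) \<le> (h \<circ> fst) X + (h \<circ> fst) (X + \<Sum>\<^sub># K)"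
        using that(9) unfolding that(4,5,8) by (simp add: Xx)
    qed (use that in simp_all)
    from conf bound[OF X Y] show ?concl
    proof (cases rule: conformal_lift_cases)
      case (flip K1 c)
      have y: "x + \<Sum>\<^sub># K1 \<in> D" and y2: "k + c = 0 \<or> k + c = 1"
        using Y unfolding Xx flip sum_mset.add_mset sum_mset_lift by (simp_all add: dom)
      have s3: "size K1 = 3" using size flip(2) by simp
      then have "K1 \<noteq> {#}" by auto
      then obtain s M1 where K1: "K1 = add_mset s M1" by (meson multiset_cases)
      have conf1: "conformal U (add_mset s M1)" using flip K1 by simp
      then have sub: "s \<in> U" "set_mset M1 \<subseteq> U" by (auto simp: conformal_def)
      have y': "x + s + \<Sum>\<^sub># M1 \<in> D" using y K1 by (simp add: add.assoc)
      have K: "X + \<Sum>\<^sub># K = (x + s + \<Sum>\<^sub># M1, k + c)"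
        unfolding Xx flip K1 sum_mset.add_mset image_mset_add_mset sum_mset_lift by (simp add: add.assoc)
      have oddc: "odd c" using flip(3) by auto
      show ?thesis
      proof (rule jump_MnatD[OF J conf1 x y'])
        assume *: "x + s \<in> D" "x + \<Sum>\<^sub># M1 \<in> D" "h (x + s) + h (x + \<Sum>\<^sub># M1) \<le> h x + h (x + s + \<Sum>\<^sub># M1)"
        have P: "X + \<Sum>\<^sub># {#?\<iota> s, (0, c)#} = (x + s, k + c)" by (simp add: Xx)
        have Q: "X + \<Sum>\<^sub># (image_mset ?\<iota> M1) = (x + \<Sum>\<^sub># M1, k)" by (simp add: Xx sum_mset_lift)
        have "(x + s, k + c) \<in> lift_dom par D"
          using * k y2 oddc par(2)[OF sub(1)] by (simp add: dom par(1))
        moreover have "(x + \<Sum>\<^sub># M1, k) \<in> lift_dom par D"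
          using * k s3 K1 parsum[OF sub(2)] by (simp add: dom par(1))
        ultimately show ?thesis
          using * s3 by (intro concl[OF _ _ _ P Q _ _ K]) (simp_all add: flip K1)
      next
        fix t N
        assume *: "M1 = add_mset t N" "x + s + t \<in> D" "x + \<Sum>\<^sub># N \<in> D"
          "h (x + s + t) + h (x + \<Sum>\<^sub># N) \<le> h x + h (x + s + \<Sum>\<^sub># M1)"
        have subt: "t \<in> U" "set_mset N \<subseteq> U" using sub * by auto
        have P: "X + \<Sum>\<^sub># {#?\<iota> s, ?\<iota> t#} = (x + s + t, k)" by (simp add: Xx)
        have Q: "X + \<Sum>\<^sub># (add_mset (0, c) (image_mset ?\<iota> N)) = (x + \<Sum>\<^sub># N, k + c)"
          by (simp add: Xx sum_mset_lift)
        have "(x + s + t, k) \<in> lift_dom par D"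
          using * k par(2)[OF sub(1)] par(2)[OF subt(1)] by (simp add: dom par(1))
        moreover have "(x + \<Sum>\<^sub># N, k + c) \<in> lift_dom par D"
          using * k y2 oddc s3 K1 parsum[OF subt(2)] by (simp add: dom par(1))
        ultimately show ?thesis
          using * s3 by (intro concl[OF _ _ _ P Q _ _ K]) (simp_all add: flip K1)
      qed
    next
      case (same K1)
      show ?thesis
      proof (rule ccontr)
        assume neg: "\<not> ?thesis"
        have size1: "size K1 = 4" using size same by simp
        let ?y = "x + \<Sum>\<^sub># K1"
        have Y1: "X + \<Sum>\<^sub># K = (?y, k)" by (simp add: Xx same sum_mset_lift)
        have y: "?y \<in> D" using Y unfolding Y1 by (simp add: dom)
        have subK: "set_mset K1 \<subseteq> U" using same(1) by (simp add: conformal_def)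
        have fail: False
          if "K1 = P + Q" "size P = 2" "size Q = 2" "x + \<Sum>\<^sub># P \<in> D" "x + \<Sum>\<^sub># Q \<in> D"
            "h (x + \<Sum>\<^sub># P) + h (x + \<Sum>\<^sub># Q) \<le> h x + h ?y" for P Q
        proof -
          have s: "X + \<Sum>\<^sub># (image_mset ?\<iota> R) = (x + \<Sum>\<^sub># R, k)" for R by (simp add: Xx sum_mset_lift)
          have "set_mset P \<subseteq> U" "set_mset Q \<subseteq> U" using subK that(1) by auto
          then have "(x + \<Sum>\<^sub># P, k) \<in> lift_dom par D" "(x + \<Sum>\<^sub># Q, k) \<in> lift_dom par D"
            using that k parsum[of P] parsum[of Q] by (simp_all add: dom par(1))
          then have ?concl
            using that by (intro concl[OF _ _ _ s s _ _ Y1]) (simp_all add: same)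
          then show False using neg by blast
        qed
        obtain u :: "nat \<Rightarrow> 'g" where u: "K1 = image_mset u (mset_set {0..<4})"
          using mset_indexed[of K1] unfolding size1 by metis
        define I where "I = {0..<4::nat}"
        have finI: "finite I" and cardI: "card I = 4" by (simp_all add: I_def)
        have uI: "K1 = image_mset u (mset_set I)" using u I_def by simp
        define S where "S = (\<lambda>P. image_mset u (mset_set P))"
        have sumS: "\<Sum>\<^sub># (S P) = sum u P" for P by (simp add: S_def sum_unfold_sum_mset)
        have sumK: "\<Sum>\<^sub># K1 = sum u I" by (simp add: uI sum_unfold_sum_mset)
        define DA where "DA = {i \<in> I. x + u i \<in> D}"
        define DB where "DB = {i \<in> I. x + sum u (I - {i}) \<in> D}"
        define val where "val = (\<lambda>P. h ` (D \<inter> {x + sum u P}))"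
        have confI: "conformal U (image_mset u (mset_set (I - {i})))" for i
          by (rule conformal_subset[OF same(1)]) (use finI in \<open>auto simp: uI\<close>)
        have card3: "card (I - {i}) = 3" if "i \<in> I" for i using that cardI by simp
        have "DA = {}"
        proof (rule four_point_descent[where g = val and I = I and \<alpha> = "h x" and \<omega> = "h ?y"
              and a = "\<lambda>i. h (x + u i)" and b = "\<lambda>i. h (x + sum u (I - {i}))" and DB = DB])
          show "card I = 4" by (rule cardI)
          show "finite (val P)" for P by (simp add: val_def)
          show "v + w > h x + h ?y" if "P \<subseteq> I" "card P = 2" "v \<in> val P" "w \<in> val (I - P)" for P v w
          proof (rule ccontr)
            assume le: "\<not> v + w > h x + h ?y"
            have finP: "finite P" using that finI finite_subset by blast
            have "mset_set I = mset_set P + mset_set (I - P)"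
              using that finI finP by (metis Diff_disjoint Diff_partition finite_Diff mset_set_Union)
            then have "K1 = S P + S (I - P)" by (simp add: S_def uI)
            moreover have "card (I - P) = 2" using that cardI finP by (simp add: card_Diff_subset)
            ultimately show False
              using fail[of "S P" "S (I - P)"] that le unfolding sumS by (auto simp: S_def val_def)
          qed
          show "\<exists>j\<in>DA. i \<in> I \<and> j \<in> I \<and> i \<noteq> j \<and>
              (\<exists>v\<in>val (I - {i, j}). h (x + u j) + v \<le> h (x + sum u (I - {i})) + h x)"
            if "i \<in> DB" for i
          proof -
            have i: "i \<in> I" "x + sum u (I - {i}) \<in> D" using that by (auto simp: DB_def)
            obtain j where j: "j \<in> I - {i}" "x + u j \<in> D" "x + sum u (I - {i} - {j}) \<in> D"
              "h (x + u j) + h (x + sum u (I - {i} - {j})) \<le> h x + h (x + sum u (I - {i}))"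
              using jump_Mnat_three_steps[OF J card3[OF i(1)] confI x i(2)] by blast
            have eq: "I - {i} - {j} = I - {i, j}" by auto
            have "h (x + sum u (I - {i, j})) \<in> val (I - {i, j})" using j(3) eq by (simp add: val_def)
            moreover have "h (x + u j) + h (x + sum u (I - {i, j})) \<le> h (x + sum u (I - {i})) + h x"
              using j(4) eq by simp
            moreover have "j \<in> DA" "i \<noteq> j" "j \<in> I" using j by (auto simp: DA_def)
            ultimately show ?thesis using i(1) by blast
          qed
          show "\<exists>j\<in>DB. i \<in> I \<and> j \<in> I \<and> i \<noteq> j \<and>
              (\<exists>v\<in>val {i, j}. h (x + sum u (I - {j})) + v \<le> h (x + u i) + h ?y)"
            if "i \<in> DA" for i
          proof -
            have i: "i \<in> I" "x + u i \<in> D" using that by (auto simp: DA_def)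
            have yeq: "x + u i + sum u (I - {i}) = ?y"
              using i(1) finI by (simp add: sumK sum.remove[of I i] add.assoc)
            obtain j where j: "j \<in> I - {i}" "x + u i + u j \<in> D" "x + u i + sum u (I - {i} - {j}) \<in> D"
              "h (x + u i + u j) + h (x + u i + sum u (I - {i} - {j})) \<le> h (x + u i) + h ?y"
              using jump_Mnat_three_steps[OF J card3[OF i(1)] confI i(2)] y unfolding yeq by blast
            have "I - {j} - {i} = I - {i} - {j}" "i \<in> I - {j}" using i j by auto
            then have "u i + sum u (I - {i} - {j}) = sum u (I - {j})"
              using finI sum.remove[of "I - {j}" i u] by simp
            then have eq: "x + u i + sum u (I - {i} - {j}) = x + sum u (I - {j})" by (simp add: add.assoc)
            have "h (x + u i + u j) \<in> val {i, j}" using j(1,2) by (auto simp: val_def add.assoc)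
            moreover have "h (x + sum u (I - {j})) + h (x + u i + u j) \<le> h (x + u i) + h ?y"
              using j(4) eq by simp
            moreover have "j \<in> DB" "i \<noteq> j" "j \<in> I" using j eq by (auto simp: DB_def)
            ultimately show ?thesis using i(1) by blast
          qed
        qed
        have "K1 \<noteq> {#}" using size1 by auto
        then obtain s M1 where K1: "K1 = add_mset s M1" by (meson multiset_cases)
        have conf1: "conformal U (add_mset s M1)" using same K1 by simp
        have yeq: "x + s + \<Sum>\<^sub># M1 = ?y" using K1 by (simp add: add.assoc)
        show False
        proof (rule jump_MnatD[OF J conf1 x])
          show "x + s + \<Sum>\<^sub># M1 \<in> D" unfolding yeq by (rule y)
        next
          assume "x + s \<in> D"
          moreover have "s \<in># K1" using K1 by simp
          then have "\<exists>i\<in>I. s = u i" using finI by (auto simp: uI)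
          ultimately show False using \<open>DA = {}\<close> by (auto simp: DA_def)
        next
          fix t N
          assume *: "M1 = add_mset t N" "x + s + t \<in> D" "x + \<Sum>\<^sub># N \<in> D"
            "h (x + s + t) + h (x + \<Sum>\<^sub># N) \<le> h x + h (x + s + \<Sum>\<^sub># M1)"
          show False
            by (rule fail[of "{#s, t#}" N]) (use *[unfolded yeq] K1 size1 in \<open>simp_all add: add.assoc\<close>)
        qed
      qed
    qed
  qed
qed

section \<open>Integer vectors and their increments\<close>

definition signed_units :: "'v set \<Rightarrow> ('v \<Rightarrow> int) set" where
  "signed_units N = unit_vector ` N \<union> (\<lambda>i. - unit_vector i) ` N"

lemma signed_units_uminus: "u \<in> signed_units N \<Longrightarrow> - u \<in> signed_units N"
  by (auto simp: signed_units_def)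

lemma unit_vector_apply: "unit_vector i j = (if j = i then 1 else 0)"
  by (simp add: unit_vector_def)

lemma signed_units_neq_uminus: "u \<in> signed_units N \<Longrightarrow> u \<noteq> - u"
proof
  assume "u \<in> signed_units N" and eq: "u = - u"
  then obtain i where "u = unit_vector i \<or> u = - unit_vector i" by (auto simp: signed_units_def)
  then have "u i = 1 \<or> u i = -1" by (auto simp: unit_vector_apply)
  moreover have "u i = - u i" using fun_cong[OF eq, of i] by simp
  ultimately show False by auto
qed

lemma signed_units_cases:
  assumes "u \<in> signed_units N" "u i > 0"
  shows "u = unit_vector i"
  using assms by (auto simp: signed_units_def unit_vector_apply split: if_splits)

lemma signed_units_cases_neg:
  assumes "u \<in> signed_units N" "u i < 0"
  shows "u = - unit_vector i"
  using assms by (auto simp: signed_units_def unit_vector_apply split: if_splits)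

lemma sum_mset_apply: "(\<Sum>\<^sub># M) i = (\<Sum>m\<in>#M. m i)" for M :: "('v \<Rightarrow> int) multiset"
  by (induction M) auto

lemma sum_mset_nonneg_int: "(\<And>m. m \<in># M \<Longrightarrow> 0 \<le> f m) \<Longrightarrow> 0 \<le> (\<Sum>m\<in>#M. f m :: int)"
  by (induction M) auto

lemma conformal_sum_pos_iff:
  assumes "conformal (signed_units N) M"
  shows "(\<Sum>\<^sub># M) i > 0 \<longleftrightarrow> unit_vector i \<in># M"
proof
  assume pos: "(\<Sum>\<^sub># M) i > 0"
  show "unit_vector i \<in># M"
  proof (rule ccontr)
    assume "unit_vector i \<notin># M"
    then have "0 \<le> - m i" if "m \<in># M" for m
      using that assms signed_units_cases[of m N i] unfolding conformal_def by force
    then have "0 \<le> (\<Sum>m\<in>#M. - m i)" by (rule sum_mset_nonneg_int)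
    also have "(\<Sum>m\<in>#M. - m i) = - (\<Sum>\<^sub># M) i" unfolding sum_mset_apply by (induction M) auto
    finally show False using pos by simp
  qed
next
  assume "unit_vector i \<in># M"
  then obtain M' where M: "M = add_mset (unit_vector i) M'" by (auto dest: multi_member_split)
  have "0 \<le> m i" if "m \<in># M'" for m
    using that assms signed_units_cases_neg[of m N i] M unfolding conformal_def by force
  then have "0 \<le> (\<Sum>m\<in>#M'. m i)" by (rule sum_mset_nonneg_int)
  then show "(\<Sum>\<^sub># M) i > 0" by (simp add: M sum_mset_apply unit_vector_apply)
qed

lemma conformal_sum_neg_iff:
  assumes "conformal (signed_units N) M"
  shows "(\<Sum>\<^sub># M) i < 0 \<longleftrightarrow> - unit_vector i \<in># M"
proof -
  have "(\<Sum>\<^sub># (image_mset uminus M)) i > 0 \<longleftrightarrow> unit_vector i \<in># image_mset uminus M"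
    by (intro conformal_sum_pos_iff conformal_uminus) (use assms signed_units_uminus in auto)
  moreover have "unit_vector i \<in># image_mset uminus M \<longleftrightarrow> - unit_vector i \<in># M"
    by (auto simp: image_iff) (metis minus_minus)
  ultimately show ?thesis by (simp add: sum_mset_uminus)
qed

lemma conformal_add_mset:
  assumes "conformal (signed_units N) M" "i \<in> N"
    and "s = unit_vector i \<and> (s + \<Sum>\<^sub># M) i > 0 \<or> s = - unit_vector i \<and> (s + \<Sum>\<^sub># M) i < 0"
  shows "conformal (signed_units N) (add_mset s M)"
proof -
  have s: "s \<in> signed_units N" using assms(2,3) by (auto simp: signed_units_def)
  have "- s \<notin># M"
    using assms(3)
  proof
    assume "s = unit_vector i \<and> (s + \<Sum>\<^sub># M) i > 0"
    then show ?thesis using conformal_sum_neg_iff[OF assms(1), of i] by (auto simp: unit_vector_apply)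
  next
    assume "s = - unit_vector i \<and> (s + \<Sum>\<^sub># M) i < 0"
    then show ?thesis using conformal_sum_pos_iff[OF assms(1), of i] by (auto simp: unit_vector_apply)
  qed
  then show ?thesis
    using assms(1) s signed_units_neq_uminus[OF s] unfolding conformal_def by auto
qed

lemma conformal_decomposition:
  assumes "finite N"
  shows "v \<in> int_vectors N \<Longrightarrow> \<exists>M. conformal (signed_units N) M \<and> \<Sum>\<^sub># M = v"
proof (induction "\<Sum>i\<in>N. nat \<bar>v i\<bar>" arbitrary: v rule: less_induct)
  case less
  show ?case
  proof (cases "v = 0")
    case True
    then show ?thesis by (intro exI[of _ "{#}"]) (simp add: conformal_def)
  next
    case False
    then obtain i where i: "v i \<noteq> 0" by (auto simp: fun_eq_iff)
    then have iN: "i \<in> N" using less.prems by (auto simp: int_vectors_def)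
    define s where "s = (if v i > 0 then unit_vector i else - unit_vector i)"
    have si: "s j = (if j = i then sgn (v i) else 0)" for j
      using i by (auto simp: s_def unit_vector_apply)
    have "(\<Sum>j\<in>N. nat \<bar>(v - s) j\<bar>) < (\<Sum>j\<in>N. nat \<bar>v j\<bar>)"
      using assms iN i by (intro sum_strict_mono_ex1) (auto simp: si sgn_if)
    moreover have "v - s \<in> int_vectors N" using less.prems iN by (auto simp: int_vectors_def si)
    ultimately obtain M where M: "conformal (signed_units N) M" "\<Sum>\<^sub># M = v - s"
      using less.hyps by blast
    have sv: "s + \<Sum>\<^sub># M = v" by (simp add: M(2))
    have "conformal (signed_units N) (add_mset s M)"
      by (rule conformal_add_mset[OF M(1) iN], unfold sv) (use i in \<open>auto simp: s_def\<close>)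
    then show ?thesis using sv by (intro exI[of _ "add_mset s M"]) simp
  qed
qed

lemma is_increment_iff:
  "is_increment N x y s \<longleftrightarrow>
    (\<exists>i\<in>N. s = unit_vector i \<and> x i < y i \<or> s = - unit_vector i \<and> y i < x i)"
proof
  assume inc: "is_increment N x y s"
  then obtain i where i: "i \<in> N" "s = unit_vector i \<or> s = - unit_vector i"
    by (auto simp: is_increment_def)
  have "inf (x i) (y i) \<le> x i + s i" "x i + s i \<le> sup (x i) (y i)"
    using inc by (auto simp: is_increment_def le_fun_def)
  then show "\<exists>i\<in>N. s = unit_vector i \<and> x i < y i \<or> s = - unit_vector i \<and> y i < x i"
    using i by (intro bexI[of _ i]) (auto simp: unit_vector_apply inf_int_def sup_int_def)
next
  assume "\<exists>i\<in>N. s = unit_vector i \<and> x i < y i \<or> s = - unit_vector i \<and> y i < x i"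
  then show "is_increment N x y s"
    by (auto simp: is_increment_def le_fun_def unit_vector_apply inf_int_def sup_int_def)
qed

lemma conformal_is_increment:
  assumes "conformal (signed_units N) (add_mset s M)"
  shows "is_increment N x (x + s + \<Sum>\<^sub># M) s"
proof -
  have "s \<in> signed_units N" using assms by (simp add: conformal_def)
  then obtain i where "i \<in> N" "s = unit_vector i \<or> s = - unit_vector i" by (auto simp: signed_units_def)
  then show ?thesis
    using conformal_sum_pos_iff[OF assms, of i] conformal_sum_neg_iff[OF assms, of i]
    unfolding is_increment_iff by (intro bexI[of _ i]) auto
qed

lemma is_increment_conformal:
  assumes "finite N" "x \<in> int_vectors N" "y \<in> int_vectors N" "is_increment N x y s"
  obtains M where "conformal (signed_units N) (add_mset s M)" "y = x + s + \<Sum>\<^sub># M"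
proof -
  obtain i where i: "i \<in> N" "s = unit_vector i \<and> x i < y i \<or> s = - unit_vector i \<and> y i < x i"
    using assms(4) unfolding is_increment_iff by blast
  have "y - x - s \<in> int_vectors N"
    using assms(2,3) i by (auto simp: int_vectors_def unit_vector_apply)
  then obtain M where M: "conformal (signed_units N) M" "\<Sum>\<^sub># M = y - x - s"
    using conformal_decomposition[OF assms(1)] by blast
  have "conformal (signed_units N) (add_mset s M)"
    by (rule conformal_add_mset[OF M(1) i(1)]) (use i(2) in \<open>auto simp: M(2)\<close>)
  then show ?thesis using that M(2) by simp
qed

lemma jump_Mnat_exchange_imp_jump_Mnat:
  assumes ex: "jump_Mnat_exchange S f" and fin: "\<And>x. x \<in> int_vectors S \<Longrightarrow> f x > -\<infinity>"
  shows "jump_Mnat (signed_units V) (eff_dom S f) (\<lambda>x. real_of_ereal (f x))"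
  unfolding jump_Mnat_def
proof (intro allI impI)
  let ?h = "\<lambda>x. real_of_ereal (f x)" and ?D = "eff_dom S f"
  fix x s M
  assume conf: "conformal (signed_units V) (add_mset s M)" and x: "x \<in> ?D" and y: "x + s + \<Sum>\<^sub># M \<in> ?D"
  let ?y = "x + s + \<Sum>\<^sub># M"
  have real: "f z = ereal (?h z)" if "z \<in> ?D" for z
    using that fin[of z] by (auto simp: eff_dom_def ereal_real)
  have real_le: "?h a + ?h b \<le> ?h c + ?h d"
    if "f c + f d \<ge> f a + f b" "a \<in> ?D" "b \<in> ?D" "c \<in> ?D" "d \<in> ?D" for a b c d
  proof -
    have "ereal (?h a + ?h b) \<le> ereal (?h c + ?h d)"
      using that(1) unfolding plus_ereal.simps(1)[symmetric] real[OF that(2), symmetric]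
        real[OF that(3), symmetric] real[OF that(4), symmetric] real[OF that(5), symmetric] .
    then show ?thesis by simp
  qed
  have "is_increment V x ?y s" by (rule conformal_is_increment[OF conf])
  then have "is_increment S x ?y s"
    using x y unfolding is_increment_iff eff_dom_def int_vectors_def by force
  then consider "x + s \<in> ?D" "?y - s \<in> ?D" "f x + f ?y \<ge> f (x + s) + f (?y - s)"
    | t where "is_increment S (x + s) ?y t" "x + s + t \<in> ?D" "?y - s - t \<in> ?D"
      "f x + f ?y \<ge> f (x + s + t) + f (?y - s - t)"
    using ex x y unfolding jump_Mnat_exchange_def by blast
  then show "(x + s \<in> ?D \<and> x + \<Sum>\<^sub># M \<in> ?D \<and> ?h (x + s) + ?h (x + \<Sum>\<^sub># M) \<le> ?h x + ?h ?y) \<or>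
      (\<exists>t N. M = add_mset t N \<and> x + s + t \<in> ?D \<and> x + \<Sum>\<^sub># N \<in> ?D \<and>
         ?h (x + s + t) + ?h (x + \<Sum>\<^sub># N) \<le> ?h x + ?h ?y)"
  proof cases
    case 1
    have "?y - s = x + \<Sum>\<^sub># M" by (simp add: algebra_simps)
    then show ?thesis using 1 real_le[OF 1(3,1,2) x y] by simp
  next
    case 2
    have cM: "conformal (signed_units V) M" by (rule conformal_subset[OF conf]) auto
    have "t \<in># M"
      using 2(1) conformal_sum_pos_iff[OF cM] conformal_sum_neg_iff[OF cM]
      unfolding is_increment_iff by auto
    then obtain N where N: "M = add_mset t N" by (auto dest: multi_member_split)
    have "?y - s - t = x + \<Sum>\<^sub># N" by (simp add: N algebra_simps)
    then show ?thesis using 2 real_le[OF 2(4,2,3) x y] N by auto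
  qed
qed

section \<open>Flows in a network\<close>

text \<open>One convolution for each arc \<open>a\<close> of a finite set, the flow on \<open>a\<close> being confined to the
  interval from \<open>l a\<close> to \<open>r a\<close>.\<close>

lemma network_envelope:
  fixes U :: "'g::ab_group_add set" and E :: "'a \<Rightarrow> int \<Rightarrow> 'g" and \<psi> :: "'a \<Rightarrow> int \<Rightarrow> real"
  assumes sym: "\<And>u. u \<in> U \<Longrightarrow> - u \<in> U" and ne: "\<And>u. u \<in> U \<Longrightarrow> u \<noteq> - u"
    and J: "jump_M U D h" and "finite C"
    and units: "\<And>a. a \<in> C \<Longrightarrow> A a \<in> U \<and> B a \<in> U"
    and E: "\<And>a k. E a (k + 1) = E a k + (A a + B a)"
    and lr: "\<And>a. a \<in> C \<Longrightarrow> l a \<le> r a"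
    and convex: "\<And>a j k. a \<in> C \<Longrightarrow> l a \<le> j \<Longrightarrow> j \<le> k \<Longrightarrow> k < r a \<Longrightarrow>
      \<psi> a (j + 1) - \<psi> a j \<le> \<psi> a (k + 1) - \<psi> a k"
  shows "\<exists>D' h'. jump_M U D' h' \<and>
    lower_envelope {(y + (\<Sum>a\<in>C. E a (\<xi> a)), h y + (\<Sum>a\<in>C. \<psi> a (\<xi> a))) | y \<xi>.
      y \<in> D \<and> (\<forall>a\<in>C. l a \<le> \<xi> a \<and> \<xi> a \<le> r a)} D' h'"
  using \<open>finite C\<close> units lr convex
proof (induction C)
  case empty
  have "lower_envelope {(y + (\<Sum>a\<in>{}. E a (\<xi> a)), h y + (\<Sum>a\<in>{}. \<psi> a (\<xi> a))) | y \<xi>.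
      y \<in> D \<and> (\<forall>a\<in>{}. l a \<le> \<xi> a \<and> \<xi> a \<le> r a)} D h"
    by (auto simp: lower_envelope_def)
  then show ?case using J by blast
next
  case (insert a C)
  let ?R = "\<lambda>C. {(y + (\<Sum>a\<in>C. E a (\<xi> a)), h y + (\<Sum>a\<in>C. \<psi> a (\<xi> a))) | y \<xi>.
      y \<in> D \<and> (\<forall>a\<in>C. l a \<le> \<xi> a \<and> \<xi> a \<le> r a)}"
  obtain D1 h1 where J1: "jump_M U D1 h1" and env1: "lower_envelope (?R C) D1 h1"
    using insert.IH insert.prems by blast
  define n where "n = nat (r a - l a)"
  have n: "l a + int n = r a" using insert.prems(2)[of a] by (simp add: n_def)
  have "\<exists>D' h'. jump_M U D' h' \<and>
    lower_envelope {(y + E a k, h1 y + \<psi> a k) | y k. y \<in> D1 \<and> l a \<le> k \<and> k \<le> l a + int n} D' h'"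
    by (rule arc_jump_M[OF sym ne J1, of "A a" "B a"])
       (use insert.prems(1,3)[of a] E n in auto)
  then obtain D2 h2 where J2: "jump_M U D2 h2" and
    env2: "lower_envelope {(y + E a k, h1 y + \<psi> a k) | y k. y \<in> D1 \<and> l a \<le> k \<and> k \<le> r a} D2 h2"
    unfolding n by blast
  have up1: "y + (\<Sum>a\<in>C. E a (\<xi> a)) \<in> D1 \<and> h1 (y + (\<Sum>a\<in>C. E a (\<xi> a))) \<le> h y + (\<Sum>a\<in>C. \<psi> a (\<xi> a))"
    if "y \<in> D" "\<forall>a\<in>C. l a \<le> \<xi> a \<and> \<xi> a \<le> r a" for y \<xi>
    by (rule lower_envelope_above[OF env1]) (use that in blast)
  have up2: "y + E a k \<in> D2 \<and> h2 (y + E a k) \<le> h1 y + \<psi> a k" if "y \<in> D1" "l a \<le> k" "k \<le> r a" for y k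
    by (rule lower_envelope_above[OF env2]) (use that in blast)
  have down1: "\<exists>y \<xi>. v = y + (\<Sum>a\<in>C. E a (\<xi> a)) \<and> y \<in> D \<and> (\<forall>a\<in>C. l a \<le> \<xi> a \<and> \<xi> a \<le> r a) \<and>
      h y + (\<Sum>a\<in>C. \<psi> a (\<xi> a)) \<le> h1 v" if "v \<in> D1" for v
    using lower_envelope_attained[OF env1 that] by blast
  have down2: "\<exists>y k. v = y + E a k \<and> y \<in> D1 \<and> l a \<le> k \<and> k \<le> r a \<and> h1 y + \<psi> a k \<le> h2 v"
    if "v \<in> D2" for v
    using lower_envelope_attained[OF env2 that] by blast
  have "lower_envelope (?R (insert a C)) D2 h2"
    unfolding lower_envelope_def
  proof (intro conjI ballI)
    fix yc assume "yc \<in> ?R (insert a C)"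
    then obtain y \<xi> where yc: "yc = (y + (\<Sum>a\<in>insert a C. E a (\<xi> a)), h y + (\<Sum>a\<in>insert a C. \<psi> a (\<xi> a)))"
      and y: "y \<in> D" "\<forall>a\<in>insert a C. l a \<le> \<xi> a \<and> \<xi> a \<le> r a" by blast
    define v where "v = y + (\<Sum>a\<in>C. E a (\<xi> a))"
    have v: "v \<in> D1" "h1 v \<le> h y + (\<Sum>a\<in>C. \<psi> a (\<xi> a))" using up1[of y \<xi>] y by (auto simp: v_def)
    have eq: "y + (\<Sum>a\<in>insert a C. E a (\<xi> a)) = v + E a (\<xi> a)"
      using insert.hyps by (simp add: v_def ac_simps)
    have "v + E a (\<xi> a) \<in> D2 \<and> h2 (v + E a (\<xi> a)) \<le> h1 v + \<psi> a (\<xi> a)"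
      using y(2) by (intro up2[OF v(1)]) auto
    then show "case yc of (y, c) \<Rightarrow> y \<in> D2 \<and> h2 y \<le> c"
      using v(2) insert.hyps unfolding yc eq by simp
  next
    fix w assume "w \<in> D2"
    then obtain v k where v: "w = v + E a k" "v \<in> D1" "l a \<le> k" "k \<le> r a" "h1 v + \<psi> a k \<le> h2 w"
      using down2 by blast
    then obtain y \<xi> where y: "v = y + (\<Sum>a\<in>C. E a (\<xi> a))" "y \<in> D" "\<forall>a\<in>C. l a \<le> \<xi> a \<and> \<xi> a \<le> r a"
      "h y + (\<Sum>a\<in>C. \<psi> a (\<xi> a)) \<le> h1 v"
      using down1 by blast
    define \<eta> where "\<eta> = \<xi>(a := k)"
    have "(\<Sum>a\<in>C. E a (\<eta> a)) = (\<Sum>a\<in>C. E a (\<xi> a))" "(\<Sum>a\<in>C. \<psi> a (\<eta> a)) = (\<Sum>a\<in>C. \<psi> a (\<xi> a))"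
      using insert.hyps by (auto simp: \<eta>_def intro!: sum.cong)
    then have "w = y + (\<Sum>a\<in>insert a C. E a (\<eta> a))"
      "h y + (\<Sum>a\<in>insert a C. \<psi> a (\<eta> a)) \<le> h2 w"
      using insert.hyps v y by (simp_all add: \<eta>_def ac_simps)
    moreover have "\<forall>a\<in>insert a C. l a \<le> \<eta> a \<and> \<eta> a \<le> r a" using y(3) v by (simp add: \<eta>_def)
    ultimately show "\<exists>c. (w, c) \<in> ?R (insert a C) \<and> c \<le> h2 w" using y(2) by blast
  qed
  then show ?case using J2 by blast
qed

lemma discrete_convex_slopes:
  assumes conv: "discrete_convex \<phi>" and fin: "\<phi> l < \<infinity>" "\<phi> r < \<infinity>"
    and jk: "l \<le> j" "j \<le> k" "k < r"
  shows "real_of_ereal (\<phi> (j + 1)) - real_of_ereal (\<phi> j) \<le> real_of_ereal (\<phi> (k + 1)) - real_of_ereal (\<phi> k)"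
proof -
  have real: "\<phi> t = ereal (real_of_ereal (\<phi> t))" if "l \<le> t" "t \<le> r" for t
  proof -
    have "\<phi> t < \<infinity>" "\<phi> t > -\<infinity>" using conv fin that unfolding discrete_convex_def by blast+
    then show ?thesis by (cases "\<phi> t") auto
  qed
  define \<psi> where "\<psi> t = real_of_ereal (\<phi> t)" for t
  have mid: "\<psi> t - \<psi> (t - 1) \<le> \<psi> (t + 1) - \<psi> t" if "l < t" "t < r" for t
  proof -
    have "\<phi> (t - 1) + \<phi> (t + 1) \<ge> 2 * \<phi> t" using conv unfolding discrete_convex_def by blast
    then have "ereal (\<psi> (t - 1)) + ereal (\<psi> (t + 1)) \<ge> ereal 2 * ereal (\<psi> t)"
      using that real[of "t - 1"] real[of "t + 1"] real[of t] by (simp add: \<psi>_def numeral_eq_ereal)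
    then show ?thesis by simp
  qed
  have "k < r \<longrightarrow> \<psi> (j + 1) - \<psi> j \<le> \<psi> (k + 1) - \<psi> k"
    using jk(2)
  proof (induction k rule: int_ge_induct)
    case (step i)
    then show ?case using mid[of "i + 1"] jk(1) by auto
  qed simp
  then show ?thesis using jk(3) by (simp add: \<psi>_def)
qed

lemma sum_fun_apply: "(\<Sum>a\<in>C. F a) v = (\<Sum>a\<in>C. F a v)" for F :: "'a \<Rightarrow> 'v \<Rightarrow> int"
  by (induction C rule: infinite_finite_induct) auto

lemma finite_pigeonhole_epsilon:
  assumes "finite X" and ex: "\<And>e::real. e > 0 \<Longrightarrow> \<exists>x\<in>X. P x e"
    and mono: "\<And>x e e'. P x e \<Longrightarrow> e \<le> e' \<Longrightarrow> P x e'"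
  shows "\<exists>x\<in>X. \<forall>e>0. P x e"
proof (rule ccontr)
  assume "\<not> ?thesis"
  then have "\<forall>x\<in>X. \<exists>e>0. \<not> P x e" by blast
  then obtain e where e: "\<And>x. x \<in> X \<Longrightarrow> e x > 0 \<and> \<not> P x (e x)" by metis
  define m where "m = Min (insert 1 (e ` X))"
  have "m > 0" using assms(1) e by (auto simp: m_def)
  then obtain x where x: "x \<in> X" "P x m" using ex by blast
  have "m \<le> e x" using assms(1) x by (simp add: m_def)
  then show False using mono[OF x(2)] e[OF x(1)] by blast
qed

text \<open>
  The change of the vertex vector caused by \<open>k\<close> units of flow on the arc \<open>a\<close>: they are taken
  from the tail and delivered to the head. The parity coordinate is unaffected.
\<close>

definition arc_shift :: "('v, 'a) pre_digraph \<Rightarrow> 'a \<Rightarrow> int \<Rightarrow> ('v \<Rightarrow> int) \<times> int" where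
  "arc_shift G a k = ((\<lambda>v. k * (unit_vector (head G a) v - unit_vector (tail G a) v)), 0)"

lemma arc_shift_add: "arc_shift G a (k + 1) =
    arc_shift G a k + ((unit_vector (head G a), 0) + (- unit_vector (tail G a), 0))"
  by (simp add: arc_shift_def fun_eq_iff algebra_simps)

lemma sum_arc_shift:
  assumes "fin_digraph G"
  shows "(\<Sum>a\<in>arcs G. arc_shift G a (\<xi> a)) = ((\<lambda>v. - net_supply G \<xi> v), 0)"
proof -
  interpret fin_digraph G by (rule assms)
  have "fst (\<Sum>a\<in>arcs G. arc_shift G a (\<xi> a)) v = - net_supply G \<xi> v" for v
  proof -
    have "fst (\<Sum>a\<in>arcs G. arc_shift G a (\<xi> a)) v =
        (\<Sum>a\<in>arcs G. \<xi> a * (unit_vector (head G a) v - unit_vector (tail G a) v))"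
      by (simp add: fst_sum sum_fun_apply arc_shift_def)
    also have "\<dots> = (\<Sum>a\<in>arcs G. if head G a = v then \<xi> a else 0) - (\<Sum>a\<in>arcs G. if tail G a = v then \<xi> a else 0)"
      unfolding sum_subtractf[symmetric]
      by (intro sum.cong refl) (auto simp: unit_vector_apply)
    also have "\<dots> = (\<Sum>a\<in>in_arcs G v. \<xi> a) - (\<Sum>a\<in>out_arcs G v. \<xi> a)"
      by (simp add: in_arcs_def out_arcs_def sum.inter_filter)
    finally show ?thesis by (simp add: net_supply_def)
  qed
  moreover have "snd (\<Sum>a\<in>arcs G. arc_shift G a (\<xi> a)) = 0" by (simp add: snd_sum arc_shift_def)
  ultimately show ?thesis by (simp add: prod_eq_iff fun_eq_iff)
qed

text \<open>
  As \<open>x\<close> vanishes outside \<open>S\<close> and \<open>y\<close> outside \<open>T\<close>, the three supply conditions say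
  together that the flow carries \<open>x\<close> to \<open>y\<close>.
\<close>

lemma feasible_flows_iff_shift:
  assumes "fin_digraph G" "S \<subseteq> verts G" "T \<subseteq> verts G" "S \<inter> T = {}"
    and "\<xi> \<in> int_vectors (arcs G)" "x \<in> int_vectors S" "y \<in> int_vectors T"
  shows "(\<xi>, x) \<in> feasible_flows G S T y \<longleftrightarrow> (x, k) + (\<Sum>a\<in>arcs G. arc_shift G a (\<xi> a)) = (y, k)"
proof -
  interpret fin_digraph G by (rule assms)
  have out: "net_supply G \<xi> v = 0" if "v \<notin> verts G" for v
  proof -
    have "in_arcs G v = {}" "out_arcs G v = {}" using that by (auto simp: in_arcs_def out_arcs_def)
    then show ?thesis by (simp add: net_supply_def)
  qed
  have x0: "x v = 0" if "v \<notin> S" for v using assms(6) that by (simp add: int_vectors_def)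
  have y0: "y v = 0" if "v \<notin> T" for v using assms(7) that by (simp add: int_vectors_def)
  have "(x, k) + (\<Sum>a\<in>arcs G. arc_shift G a (\<xi> a)) = (y, k) \<longleftrightarrow> (\<forall>v. net_supply G \<xi> v = x v - y v)"
    unfolding sum_arc_shift[OF assms(1)] by (auto simp: fun_eq_iff algebra_simps)
  also have "\<dots> \<longleftrightarrow> (\<xi>, x) \<in> feasible_flows G S T y"
  proof
    assume "\<forall>v. net_supply G \<xi> v = x v - y v"
    then show "(\<xi>, x) \<in> feasible_flows G S T y"
      using assms(4-6) x0 y0 by (auto simp: feasible_flows_def)
  next
    assume F: "(\<xi>, x) \<in> feasible_flows G S T y"
    show "\<forall>v. net_supply G \<xi> v = x v - y v"
    proof
      fix v
      consider "v \<in> S" "v \<notin> T" | "v \<in> T" "v \<notin> S" | "v \<in> verts G - (S \<union> T)" | "v \<notin> verts G" "v \<notin> S" "v \<notin> T"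
        using assms(2-4) by blast
      then show "net_supply G \<xi> v = x v - y v"
        by cases (use F x0 y0 out in \<open>auto simp: feasible_flows_def\<close>)
    qed
  qed
  finally show ?thesis by blast
qed

text \<open>The cost of a flow as a real number; it is the true cost when all its terms are finite.\<close>

definition real_cost ::
    "('v, 'a) pre_digraph \<Rightarrow> ('a \<Rightarrow> int \<Rightarrow> ereal) \<Rightarrow> (('v \<Rightarrow> int) \<Rightarrow> ereal) \<Rightarrow> ('a \<Rightarrow> int) \<Rightarrow> ('v \<Rightarrow> int) \<Rightarrow> real" where
  "real_cost G \<phi> f \<xi> x = real_of_ereal (f x) + (\<Sum>a\<in>arcs G. real_of_ereal (\<phi> a (\<xi> a)))"

lemma ereal_cost:
  assumes "\<And>a. a \<in> arcs G \<Longrightarrow> discrete_convex (\<phi> a)" "f x > -\<infinity>" "f x < \<infinity>"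
    and "\<And>a. a \<in> arcs G \<Longrightarrow> \<phi> a (\<xi> a) < \<infinity>"
  shows "f x + (\<Sum>a\<in>arcs G. \<phi> a (\<xi> a)) = ereal (real_cost G \<phi> f \<xi> x)"
proof -
  have "\<phi> a (\<xi> a) = ereal (real_of_ereal (\<phi> a (\<xi> a)))" if "a \<in> arcs G" for a
  proof -
    have "\<phi> a (\<xi> a) > -\<infinity>" using assms(1)[OF that] unfolding discrete_convex_def by blast
    then show ?thesis using assms(4)[OF that] by (cases "\<phi> a (\<xi> a)") auto
  qed
  then have "(\<Sum>a\<in>arcs G. \<phi> a (\<xi> a)) = ereal (\<Sum>a\<in>arcs G. real_of_ereal (\<phi> a (\<xi> a)))"
    unfolding sum_ereal[symmetric] by (rule sum.cong[OF refl])
  moreover have "f x = ereal (real_of_ereal (f x))" using assms(2,3) by (cases "f x") auto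
  ultimately show ?thesis unfolding real_cost_def plus_ereal.simps(1)[symmetric] by metis
qed

theorem theorem4p12:
  fixes G :: "('v, 'a) pre_digraph"
    and S T :: "'v set"
    and \<phi> :: "'a \<Rightarrow> int \<Rightarrow> ereal"
    and f :: "('v \<Rightarrow> int) \<Rightarrow> ereal"
  defines "g \<equiv> network_transform G S T \<phi> f"
  assumes "fin_digraph G"
    and "S \<subseteq> verts G" and "T \<subseteq> verts G" and "S \<inter> T = {}"
    and "\<And>a. a \<in> arcs G \<Longrightarrow> discrete_convex (\<phi> a)"
    and "jump_Mnat_convex S f"
    and "eff_dom T g \<noteq> {}"
    and "\<And>y. y \<in> int_vectors T \<Longrightarrow> g y > -\<infinity>"
  shows "jump_Mnat_convex T g"
proof -
  interpret fin_digraph G by (rule assms(2))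
  have conv: "discrete_convex (\<phi> a)" if "a \<in> arcs G" for a by (rule assms(6)[OF that])
  have finT: "finite T" using assms(4) finite_verts finite_subset by blast
  have f_ninf: "f x > -\<infinity>" if "x \<in> int_vectors S" for x
    using assms(7) that by (simp add: jump_Mnat_convex_def)
  have ex_f: "jump_Mnat_exchange S f" using assms(7) by (simp add: jump_Mnat_convex_def)
  note shift_iff = feasible_flows_iff_shift[OF assms(2-5)]
  let ?V = "signed_units (verts G)" and ?D = "eff_dom S f" and ?h = "\<lambda>x. real_of_ereal (f x)"
  let ?U = "lift_units ?V"
  define par where "par = (\<lambda>x :: 'v \<Rightarrow> int. \<Sum>v\<in>verts G. x v)"
  have par_add: "par (x + y) = par x + par y" for x y by (simp add: par_def sum.distrib)
  have par_odd: "odd (par u)" if "u \<in> ?V" for u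
    using that finite_verts by (auto simp: signed_units_def par_def unit_vector_apply sum_negf)
  have U_sym: "- u \<in> ?U" if "u \<in> ?U" for u
    using that signed_units_uminus[of _ "verts G"] by (auto simp: lift_units_def)
  have U_ne: "u \<noteq> - u" if "u \<in> ?U" for u
    using that signed_units_neq_uminus[of _ "verts G"] by (auto simp: lift_units_def)
  define L where "L = lift_dom par ?D"
  have JL: "jump_M ?U L (?h \<circ> fst)"
    unfolding L_def
  proof (rule lift_jump_M)
    show "jump_Mnat ?V ?D ?h" by (rule jump_Mnat_exchange_imp_jump_Mnat[OF ex_f f_ninf])
  qed (use signed_units_uminus par_add par_odd in blast)+
  have L_mod: "(x, par x mod 2) \<in> L" if "x \<in> ?D" for x
    using that by (auto simp: L_def lift_dom_def)
  have g_le: "g y \<le> ereal (real_cost G \<phi> f \<xi> x)"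
    if "(\<xi>, x) \<in> feasible_flows G S T y" "x \<in> ?D" "\<And>a. a \<in> arcs G \<Longrightarrow> \<phi> a (\<xi> a) < \<infinity>" for y \<xi> x
  proof -
    have x: "f x > -\<infinity>" "f x < \<infinity>" using that(2) f_ninf by (auto simp: eff_dom_def)
    have "g y \<le> f x + (\<Sum>a\<in>arcs G. \<phi> a (\<xi> a))"
      unfolding g_def network_transform_def using that(1) by (intro INF_lower2[of "(\<xi>, x)"]) auto
    also have "\<dots> = ereal (real_cost G \<phi> f \<xi> x)"
      by (rule ereal_cost) (use conv x that(3) in auto)
    finally show ?thesis .
  qed
  have near: "\<exists>\<xi> x. (\<xi>, x) \<in> feasible_flows G S T y \<and> x \<in> ?D \<and> (\<forall>a\<in>arcs G. \<phi> a (\<xi> a) < \<infinity>) \<and>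
      ereal (real_cost G \<phi> f \<xi> x) < g y + ereal e"
    if "y \<in> eff_dom T g" "e > 0" for y e
  proof -
    have "g y > -\<infinity>" "g y < \<infinity>" using that(1) assms(9) by (auto simp: eff_dom_def)
    then have "g y < g y + ereal e" using that(2) by (cases "g y") auto
    then have "(INF (\<xi>, x)\<in>feasible_flows G S T y. f x + (\<Sum>a\<in>arcs G. \<phi> a (\<xi> a))) < g y + ereal e"
      unfolding g_def network_transform_def .
    then obtain \<xi> x where F: "(\<xi>, x) \<in> feasible_flows G S T y"
      and lt: "f x + (\<Sum>a\<in>arcs G. \<phi> a (\<xi> a)) < g y + ereal e"
      unfolding INF_less_iff by auto
    have "f x + (\<Sum>a\<in>arcs G. \<phi> a (\<xi> a)) \<noteq> \<infinity>" using lt by auto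
    then have fx: "f x \<noteq> \<infinity>" and "(\<Sum>a\<in>arcs G. \<phi> a (\<xi> a)) \<noteq> \<infinity>" by auto
    then have ph: "\<phi> a (\<xi> a) < \<infinity>" if "a \<in> arcs G" for a
      using that finite_arcs by (auto simp: sum_Pinfty)
    have xS: "x \<in> int_vectors S" using F by (auto simp: feasible_flows_def)
    then have "x \<in> ?D" using fx by (simp add: eff_dom_def)
    moreover have "f x + (\<Sum>a\<in>arcs G. \<phi> a (\<xi> a)) = ereal (real_cost G \<phi> f \<xi> x)"
      by (rule ereal_cost) (use conv f_ninf[OF xS] fx ph in auto)
    then have "ereal (real_cost G \<phi> f \<xi> x) < g y + ereal e" using lt by simp
    ultimately show ?thesis using F ph by blast
  qed
  have exchange: "(y1 + s \<in> eff_dom T g \<and> y2 - s \<in> eff_dom T g \<and> g y1 + g y2 \<ge> g (y1 + s) + g (y2 - s)) \<or>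
        (\<exists>t. is_increment T (y1 + s) y2 t \<and>
             y1 + s + t \<in> eff_dom T g \<and> y2 - s - t \<in> eff_dom T g \<and>
             g y1 + g y2 \<ge> g (y1 + s + t) + g (y2 - s - t))"
    if y1: "y1 \<in> eff_dom T g" and y2: "y2 \<in> eff_dom T g" and inc: "is_increment T y1 y2 s" for y1 y2 s
  proof -
    have yT: "y1 \<in> int_vectors T" "y2 \<in> int_vectors T" using y1 y2 by (auto simp: eff_dom_def)
    obtain M where M: "conformal (signed_units T) (add_mset s M)" "y2 = y1 + s + \<Sum>\<^sub># M"
      by (rule is_increment_conformal[OF finT yT inc])
    \<comment> \<open>\<open>t = 0\<close> stands for an exchange by \<open>s\<close> alone\<close>
    define P where "P = (\<lambda>t e. y1 + s + t \<in> eff_dom T g \<and> y2 - s - t \<in> eff_dom T g \<and>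
        g (y1 + s + t) + g (y2 - s - t) \<le> g y1 + g y2 + ereal e)"
    have approx: "\<exists>t\<in>insert 0 (set_mset M). P t e" if e: "e > 0" for e
    proof -
      obtain \<xi>1 x1 where 1: "(\<xi>1, x1) \<in> feasible_flows G S T y1" "x1 \<in> ?D"
        "\<forall>a\<in>arcs G. \<phi> a (\<xi>1 a) < \<infinity>" "ereal (real_cost G \<phi> f \<xi>1 x1) < g y1 + ereal (e / 2)"
        using near[OF y1, of "e / 2"] e by auto
      obtain \<xi>2 x2 where 2: "(\<xi>2, x2) \<in> feasible_flows G S T y2" "x2 \<in> ?D"
        "\<forall>a\<in>arcs G. \<phi> a (\<xi>2 a) < \<infinity>" "ereal (real_cost G \<phi> f \<xi>2 x2) < g y2 + ereal (e / 2)"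
        using near[OF y2, of "e / 2"] e by auto
      define l where "l = (\<lambda>a. min (\<xi>1 a) (\<xi>2 a))"
      define r where "r = (\<lambda>a. max (\<xi>1 a) (\<xi>2 a))"
      have lr_fin: "\<phi> a (l a) < \<infinity>" "\<phi> a (r a) < \<infinity>" if "a \<in> arcs G" for a
        using 1(3) 2(3) that by (auto simp: l_def r_def min_def max_def)
      have between_fin: "\<phi> a k < \<infinity>" if "a \<in> arcs G" "l a \<le> k" "k \<le> r a" for a k
        using conv[OF that(1)] lr_fin[OF that(1)] that(2,3) unfolding discrete_convex_def by blast
      let ?\<psi> = "\<lambda>a k. real_of_ereal (\<phi> a k)"
      let ?R = "{(y + (\<Sum>a\<in>arcs G. arc_shift G a (\<xi> a)), (?h \<circ> fst) y + (\<Sum>a\<in>arcs G. ?\<psi> a (\<xi> a))) | y \<xi>.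
          y \<in> L \<and> (\<forall>a\<in>arcs G. l a \<le> \<xi> a \<and> \<xi> a \<le> r a)}"
      have "\<exists>D' h'. jump_M ?U D' h' \<and> lower_envelope ?R D' h'"
      proof (rule network_envelope[OF U_sym U_ne JL finite_arcs,
            where A = "\<lambda>a. (unit_vector (head G a), 0)" and B = "\<lambda>a. (- unit_vector (tail G a), 0)"])
        show "(unit_vector (head G a), 0) \<in> ?U \<and> (- unit_vector (tail G a), 0) \<in> ?U" if "a \<in> arcs G" for a
          using that by (auto simp: lift_units_def signed_units_def)
        show "arc_shift G a (k + 1) = arc_shift G a k +
            ((unit_vector (head G a), 0) + (- unit_vector (tail G a), 0))" for a k
          by (rule arc_shift_add)
        show "l a \<le> r a" for a by (simp add: l_def r_def)
        show "?\<psi> a (j + 1) - ?\<psi> a j \<le> ?\<psi> a (k + 1) - ?\<psi> a k"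
          if "a \<in> arcs G" "l a \<le> j" "j \<le> k" "k < r a" for a j k
          by (rule discrete_convex_slopes[OF conv[OF that(1)] lr_fin[OF that(1)] that(2-4)])
      qed
      then obtain D' h' where J': "jump_M ?U D' h'" and env: "lower_envelope ?R D' h'" by blast
      have up: "(y, par x mod 2) \<in> D' \<and> h' (y, par x mod 2) \<le> real_cost G \<phi> f \<xi> x"
        if F: "(\<xi>, x) \<in> feasible_flows G S T y" and x: "x \<in> ?D" and y: "y \<in> int_vectors T"
          and "\<forall>a\<in>arcs G. l a \<le> \<xi> a \<and> \<xi> a \<le> r a" for \<xi> x y
      proof -
        have "\<xi> \<in> int_vectors (arcs G)" "x \<in> int_vectors S" using F by (auto simp: feasible_flows_def)
        then have sh: "(x, par x mod 2) + (\<Sum>a\<in>arcs G. arc_shift G a (\<xi> a)) = (y, par x mod 2)"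
          using shift_iff[OF _ _ y] F by blast
        have cost: "real_cost G \<phi> f \<xi> x = (?h \<circ> fst) (x, par x mod 2) + (\<Sum>a\<in>arcs G. ?\<psi> a (\<xi> a))"
          by (simp add: real_cost_def)
        have "((y, par x mod 2), real_cost G \<phi> f \<xi> x) \<in> ?R"
          unfolding sh[symmetric] cost
          by (rule CollectI, rule exI[of _ "(x, par x mod 2)"], rule exI[of _ \<xi>])
             (use L_mod[OF x] that(4) in simp)
        then show ?thesis by (rule lower_envelope_above[OF env])
      qed
      have down: "y \<in> eff_dom T g \<and> g y \<le> ereal (h' (y, k))"
        if D': "(y, k) \<in> D'" and y: "y \<in> int_vectors T" for y k
      proof -
        obtain X \<xi> where X: "(y, k) = X + (\<Sum>a\<in>arcs G. arc_shift G a (\<xi> a))" "X \<in> L"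
          "\<forall>a\<in>arcs G. l a \<le> \<xi> a \<and> \<xi> a \<le> r a" "(?h \<circ> fst) X + (\<Sum>a\<in>arcs G. ?\<psi> a (\<xi> a)) \<le> h' (y, k)"
          using lower_envelope_attained[OF env D'] by blast
        define \<eta> where "\<eta> = (\<lambda>a. if a \<in> arcs G then \<xi> a else 0)"
        obtain x k' where Xx: "X = (x, k')" by (cases X)
        have sh: "(\<Sum>a\<in>arcs G. arc_shift G a (\<xi> a)) = (\<Sum>a\<in>arcs G. arc_shift G a (\<eta> a))"
          by (rule sum.cong) (simp_all add: \<eta>_def)
        have "k' = k" using X(1) unfolding Xx sum_arc_shift[OF assms(2)] by simp
        have xD: "x \<in> ?D" using X(2) by (auto simp: Xx L_def lift_dom_def)
        then have "x \<in> int_vectors S" by (simp add: eff_dom_def)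
        moreover have "\<eta> \<in> int_vectors (arcs G)" by (simp add: \<eta>_def int_vectors_def)
        ultimately have F: "(\<eta>, x) \<in> feasible_flows G S T y"
          using shift_iff[OF _ _ y, of \<eta> x k] X(1)[symmetric] unfolding Xx sh \<open>k' = k\<close> by blast
        have "\<phi> a (\<eta> a) < \<infinity>" if "a \<in> arcs G" for a
          using between_fin[OF that, of "\<xi> a"] X(3) that by (simp add: \<eta>_def)
        then have "g y \<le> ereal (real_cost G \<phi> f \<eta> x)" by (rule g_le[OF F xD])
        also have "real_cost G \<phi> f \<eta> x = (?h \<circ> fst) X + (\<Sum>a\<in>arcs G. ?\<psi> a (\<xi> a))"
          by (simp add: real_cost_def Xx \<eta>_def)
        finally have "g y \<le> ereal (h' (y, k))" using X(4) by (meson ereal_less_eq(3) order_trans)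
        moreover from this have "g y < \<infinity>" by (rule order.strict_trans1) simp
        ultimately show ?thesis using y by (simp add: eff_dom_def)
      qed
      define k1 where "k1 = par x1 mod 2"
      define k2 where "k2 = par x2 mod 2"
      have Y1: "(y1, k1) \<in> D'" "h' (y1, k1) \<le> real_cost G \<phi> f \<xi>1 x1"
        using up[OF 1(1,2) yT(1)] by (auto simp: k1_def l_def r_def)
      have Y2: "(y2, k2) \<in> D'" "h' (y2, k2) \<le> real_cost G \<phi> f \<xi>2 x2"
        using up[OF 2(1,2) yT(2)] by (auto simp: k2_def l_def r_def)
      \<comment> \<open>the step of the parity coordinate between the two lifted points, if there is one\<close>
      define R where "R = (if k1 = k2 then {#} else {#(0 :: 'v \<Rightarrow> int, k2 - k1)#})"
      have k12: "k2 - k1 = 0 \<or> k2 - k1 = 1 \<or> k2 - k1 = -1"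
        unfolding k1_def k2_def by presburger
      let ?\<iota> = "\<lambda>u :: 'v \<Rightarrow> int. (u, 0 :: int)"
      define M' where "M' = image_mset ?\<iota> M + R"
      have "conformal ?V (add_mset s M)"
        using M(1) assms(4) unfolding conformal_def signed_units_def by blast
      then have conf: "conformal ?U (add_mset (?\<iota> s) M')"
        using k12 unfolding conformal_def lift_units_def M'_def R_def by auto
      have sumM': "(y1, k1) + ?\<iota> s + \<Sum>\<^sub># M' = (y2, k2)"
        by (auto simp: M'_def R_def sum_mset_lift M(2))
      obtain tt N where N: "M' = add_mset tt N" "(y1, k1) + ?\<iota> s + tt \<in> D'" "(y1, k1) + \<Sum>\<^sub># N \<in> D'"
        "h' ((y1, k1) + ?\<iota> s + tt) + h' ((y1, k1) + \<Sum>\<^sub># N) \<le> h' (y1, k1) + h' (y2, k2)"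
        using J' conf Y1(1) Y2(1) unfolding jump_M_def sumM'[symmetric] by blast
      define t where "t = fst tt"
      have "tt \<in># M'" using N(1) by simp
      then have t: "t \<in> insert 0 (set_mset M)" by (auto simp: t_def M'_def R_def split: if_splits)
      have tT: "t \<in> int_vectors T" and sT: "s \<in> int_vectors T"
        using t M(1) unfolding conformal_def signed_units_def int_vectors_def
        by (auto simp: unit_vector_apply)
      obtain i where i: "(y1, k1) + ?\<iota> s + tt = (y1 + s + t, i)" unfolding t_def by (cases tt) auto
      have "(y1, k1) + ?\<iota> s + (tt + \<Sum>\<^sub># N) = (y2, k2)" using sumM' N(1) by simp
      then have "fst ((y1, k1) + ?\<iota> s + (tt + \<Sum>\<^sub># N)) = y2" by simp
      then have "fst ((y1, k1) + \<Sum>\<^sub># N) = y2 - s - t" by (simp add: t_def algebra_simps)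
      then obtain j where j: "(y1, k1) + \<Sum>\<^sub># N = (y2 - s - t, j)" by (metis prod.collapse)
      have z1: "y1 + s + t \<in> int_vectors T" and z2: "y2 - s - t \<in> int_vectors T"
        using tT sT yT by (auto simp: int_vectors_def)
      have d1: "y1 + s + t \<in> eff_dom T g \<and> g (y1 + s + t) \<le> ereal (h' (y1 + s + t, i))"
        using down[OF _ z1] N(2) unfolding i by blast
      have d2: "y2 - s - t \<in> eff_dom T g \<and> g (y2 - s - t) \<le> ereal (h' (y2 - s - t, j))"
        using down[OF _ z2] N(3) unfolding j by blast
      have "g (y1 + s + t) + g (y2 - s - t) \<le> ereal (h' (y1 + s + t, i)) + ereal (h' (y2 - s - t, j))"
        using d1 d2 by (intro add_mono) auto
      also have "\<dots> \<le> ereal (real_cost G \<phi> f \<xi>1 x1) + ereal (real_cost G \<phi> f \<xi>2 x2)"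
        using N(4) Y1(2) Y2(2) unfolding i j by simp
      also have "\<dots> \<le> (g y1 + ereal (e / 2)) + (g y2 + ereal (e / 2))"
        using 1(4) 2(4) by (intro add_mono) auto
      also have "\<dots> = g y1 + g y2 + (ereal (e / 2) + ereal (e / 2))" by (simp only: ac_simps)
      finally have "P t e" using d1 d2 by (simp add: P_def)
      then show ?thesis using t by blast
    qed
    have P_mono: "P t e'" if "P t e" "e \<le> e'" for t e e'
    proof -
      have "g y1 + g y2 + ereal e \<le> g y1 + g y2 + ereal e'" using that(2) by (intro add_left_mono) simp
      then show ?thesis using that(1) unfolding P_def by (meson order_trans)
    qed
    have "\<exists>t\<in>insert 0 (set_mset M). \<forall>e>0. P t e"
      by (rule finite_pigeonhole_epsilon[OF _ approx P_mono]) simp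
    then obtain t where t: "t \<in> insert 0 (set_mset M)" "\<forall>e>0. P t e" by blast
    have "P t 1" using t(2) by simp
    then have dom: "y1 + s + t \<in> eff_dom T g" "y2 - s - t \<in> eff_dom T g" by (auto simp: P_def)
    have le: "g (y1 + s + t) + g (y2 - s - t) \<le> g y1 + g y2"
      by (rule ereal_le_epsilon2) (use t(2) in \<open>simp add: P_def\<close>)
    show ?thesis
    proof (cases "t = 0")
      case True
      then show ?thesis using dom le by simp
    next
      case False
      then obtain N where N: "M = add_mset t N" using t(1) by (auto dest: multi_member_split)
      have "conformal (signed_units T) (add_mset t N)"
        by (rule conformal_subset[OF M(1)]) (auto simp: N)
      then have "is_increment T (y1 + s) (y1 + s + t + \<Sum>\<^sub># N) t" by (rule conformal_is_increment)
      moreover have "y1 + s + t + \<Sum>\<^sub># N = y2" by (simp add: M(2) N add.assoc)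
      ultimately show ?thesis using dom le by auto
    qed
  qed
  show ?thesis
    unfolding jump_Mnat_convex_def jump_Mnat_exchange_def
    using finT assms(8,9) exchange by blast
qed

end
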